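(* Let $T,K\ge 1$ be integers and let $\mathcal{K}\subset\mathbb{R}^n$ be a nonempty convex compact set with diameter $D=\sup_{\mathbf{x},\mathbf{y}\in\mathcal{K}}\|\mathbf{x}-\mathbf{y}\|$ and radius $R=\sup_{\mathbf{x}\in\mathcal{K}}\|\mathbf{x}\|$. Let $f_1,\dots,f_T$ be an arbitrary sequence of differentiable functions, each $L$-smooth. Suppose that each $f_t$ comes with a stochastic gradient oracle $\tilde\nabla f_t$ that is unbiased, $\mathbb{E}[\nabla f_t(\mathbf{x})-\tilde\nabla f_t(\mathbf{x})]=0$, and has bounded variance, $\mathbb{E}[\|\nabla f_t(\mathbf{x})-\tilde\nabla f_t(\mathbf{x})\|^2]\le\sigma^2$, for all points $\mathbf{x}$ and all $t$. Run the Meta-Frank-Wolfe algorithm (described in the context) with online linear optimization oracles $\mathcal{E}^{(1)},\dots,\mathcal{E}^{(K)}$ over $\mathcal{K}$, each with regret at most $\mathcal{R}_T^{\mathcal{E}}$ after $T$ rounds, and with averaging parameters $\rho_k=\frac{2}{(k+3)^{2/3}}$. Let $\mathbf{x}_t$ denote the point it plays in round $t$ and $\mathbf{z}$ its initial point. (1) (Convex minimization.) Suppose $f_1,\dots,f_T$ are convex, the algorithm is run in its convex version with any initial point $\mathbf{z}\in\mathcal{K}$, and the step sizes are $\eta_k=\frac{1}{k+3}$. Let $\mathbf{x}^*\in\arg\min_{\mathbf{x}\in\mathcal{K}}\sum_{t=1}^T f_t(\mathbf{x})$. Then $$\mathbb{E}\Big[\sum_{t=1}^T f_t(\mathbf{x}_t)\Big]-\inf_{\mathbf{x}\in\mathcal{K}}\sum_{t=1}^T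 f_t(\mathbf{x})\;\le\;\frac{4TDQ^{1/2}}{K^{1/3}}+\frac{4T}{K}\Big(M+\frac{LD^2}{3}\log(K+1)\Big)+\frac43\,\mathcal{R}_T^{\mathcal{E}},$$ where $M=\max_{1\le t\le T}[f_t(\mathbf{z})-f_t(\mathbf{x}^* )]$ and $Q=\max\{4^{2/3}\max_{1\le t\le T}\|\nabla f_t(\mathbf{z})\|^2,\;4\sigma^2+3(LD)^2/2\}$. (2) (DR-submodular maximization.) Suppose $f_1,\dots,f_T$ are monotone continuous DR-submodular, the algorithm is run in its submodular version with initial point $\mathbf{z}=0$, and the step sizes are $\eta_k=\frac1K$. Then $$\Big(1-\frac1e\Big)\sup_{\mathbf{x}\in\mathcal{K}}\sum_{t=1}^T f_t(\mathbf{x})-\mathbb{E}\Big[\sum_{t=1}^T f_t(\mathbf{x}_t)\Big]\;\le\;\frac{3TDQ^{1/2}}{2K^{1/3}}+\frac{LD^2T}{2K}+\mathcal{R}_T^{\mathcal{E}},$$ where $Q=\max\{4^{2/3}\max_{1\le t\le T}\|\nabla f_t(0)\|^2,\;4\sigma^2+6L^2R^2\}$. The expectations are with respect to the stochastic gradient estimates.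
   Context: Norms are Euclidean and $\langle\cdot,\cdot\rangle$ is the standard inner product; inequalities between vectors are componentwise. A differentiable $f$ is $L$-smooth if $\|\nabla f(\mathbf{x})-\nabla f(\mathbf{y})\|\le L\|\mathbf{x}-\mathbf{y}\|$ for all $\mathbf{x},\mathbf{y}$ in its domain. In the convex case the domain is a convex set containing $\mathcal{K}$. In the submodular case the functions are defined on a box $\mathcal{X}=\prod_{i=1}^n\mathcal{X}_i$, where each $\mathcal{X}_i\subset\mathbb{R}_+$ is a compact interval containing $0$, take values in $\mathbb{R}_+$ (nonnegative), and $\mathcal{K}\subset\mathcal{X}$ (the set $\mathcal{K}$ need not be down-closed and need not contain $0$). Such an $f$ is continuous DR-submodular if it is differentiable and $\nabla f(\mathbf{x})\ge\nabla f(\mathbf{y})$ whenever $\mathbf{x}\le\mathbf{y}$; it is monotone if $f(\mathbf{x})\le f(\mathbf{y})$ whenever $\mathbf{x}\le\mathbf{y}$. Stochastic gradient oracle: each query of $\tilde\nabla f_t$ at a point returns a fresh random vector; the unbiasedness and variance conditions hold conditionally on all randomness generated before that query. The sequence $f_1,\dots,f_T$ is fixed in advance, but $f_t$ is only revealed after the point of round $t$ has been played. Online linear optimization oracle with regret at most $\mathcal{R}_T^{\mathcal{E}}$: an online algorithm that in each round $t=1,\dots,T$ outputs a point $\mathbf{v}_t\in\mathcal{K}$ depending only on the vectors $\mathbf{d}_1,\dots,\mathbf{d}_{t-1}$ fed to it in previous rounds, and then receives a vector $\mathbf{d}_t$ (representing the linear objective $\langle\cdot,\mathbf{d}_t\rangle$).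 In the convex version the oracle is a minimizing one: for all sequences of vectors, $\sum_{t=1}^T\langle\mathbf{d}_t,\mathbf{v}_t\rangle-\min_{\mathbf{x}\in\mathcal{K}}\sum_{t=1}^T\langle\mathbf{d}_t,\mathbf{x}\rangle\le\mathcal{R}_T^{\mathcal{E}}$. In the submodular version it is a maximizing one: $\max_{\mathbf{x}\in\mathcal{K}}\sum_{t=1}^T\langle\mathbf{d}_t,\mathbf{x}\rangle-\sum_{t=1}^T\langle\mathbf{d}_t,\mathbf{v}_t\rangle\le\mathcal{R}_T^{\mathcal{E}}$. Meta-Frank-Wolfe algorithm with parameters $\rho_k,\eta_k\in(0,1)$, $k=1,\dots,K$ (with $\eta_k=1/K$ in the submodular version), and initial point $\mathbf{z}$. For every $t$ put $\mathbf{d}_t^{(0)}=0$ and $\mathbf{x}_t^{(1)}=\mathbf{z}$. In each round $t=1,\dots,T$: (i) let $\mathbf{v}_t^{(k)}$ be the current output of oracle $\mathcal{E}^{(k)}$, for $k=1,\dots,K$ (based on the feedback of rounds $1,\dots,t-1$); (ii) for $k=1,\dots,K$ set $\mathbf{x}_t^{(k+1)}=(1-\eta_k)\mathbf{x}_t^{(k)}+\eta_k\mathbf{v}_t^{(k)}$ in the convex version, and $\mathbf{x}_t^{(k+1)}=\mathbf{x}_t^{(k)}+\eta_k\mathbf{v}_t^{(k)}$ in the submodular version; (iii) play $\mathbf{x}_t=\mathbf{x}_t^{(K+1)}$; then $f_t$ is revealed through its value $f_t(\mathbf{x}_t)$ and access to the stochastic gradient oracle $\tilde\nabla f_t$; (iv)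 for $k=1,\dots,K$ set $\mathbf{d}_t^{(k)}=(1-\rho_k)\mathbf{d}_t^{(k-1)}+\rho_k\tilde\nabla f_t(\mathbf{x}_t^{(k)})$; (v) feed $\mathbf{d}_t^{(k)}$ (the linear objective $\langle\cdot,\mathbf{d}_t^{(k)}\rangle$) to oracle $\mathcal{E}^{(k)}$, for $k=1,\dots,K$. *)

theory Defs
  imports "HOL-Probability.Probability"
begin

text \<open>The derivative is taken within the domain, so that points on its boundary are covered.
  The gradient field is a parameter; it is determined by the function whenever the
  convex domain has nonempty interior.\<close>

definition has_gradient_on ::
  "('a::euclidean_space \<Rightarrow> real) \<Rightarrow> ('a \<Rightarrow> 'a) \<Rightarrow> 'a set \<Rightarrow> bool" where
  "has_gradient_on f g S \<longleftrightarrow>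
     (\<forall>x\<in>S. (f has_derivative (\<lambda>h. g x \<bullet> h)) (at x within S))"

definition smooth_on ::
  "real \<Rightarrow> ('a::euclidean_space \<Rightarrow> real) \<Rightarrow> ('a \<Rightarrow> 'a) \<Rightarrow> 'a set \<Rightarrow> bool" where
  "smooth_on L f g S \<longleftrightarrow> has_gradient_on f g S \<and> L-lipschitz_on S g"

definition dr_submodular_on ::
  "(real ^ 'n \<Rightarrow> real) \<Rightarrow> (real ^ 'n \<Rightarrow> real ^ 'n) \<Rightarrow> (real ^ 'n) set \<Rightarrow> bool" where
  "dr_submodular_on f g S \<longleftrightarrow>
     has_gradient_on f g S \<and> (\<forall>x\<in>S. \<forall>y\<in>S. x \<le> y \<longrightarrow> g y \<le> g x)"

text \<open>\<open>G y \<omega>\<close> is the vector returned when one particular query is made at the point \<open>y\<close>, and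
  \<open>H\<close> is the information available before this query. The query point may itself be random
  as long as it is determined by \<open>H\<close>; constant points \<open>X\<close> are included. The conditional
  expectation of the error is taken componentwise.\<close>

definition stochastic_gradient_query ::
  "'w measure \<Rightarrow> 'w measure \<Rightarrow> 'a::euclidean_space set \<Rightarrow> ('a \<Rightarrow> 'a) \<Rightarrow> real
    \<Rightarrow> ('a \<Rightarrow> 'w \<Rightarrow> 'a) \<Rightarrow> bool" where
  "stochastic_gradient_query M H S g \<sigma> G \<longleftrightarrow>
     (\<forall>X \<in> borel_measurable H. (\<forall>\<omega>\<in>space M. X \<omega> \<in> S) \<longrightarrow>
        (\<lambda>\<omega>. G (X \<omega>) \<omega>) \<in> borel_measurable M \<and>
        integrable M (\<lambda>\<omega>. (norm (g (X \<omega>) - G (X \<omega>) \<omega>))\<^sup>2) \<and>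
        (\<forall>b\<in>Basis. AE \<omega> in M.
           real_cond_exp M H (\<lambda>\<omega>. (g (X \<omega>) - G (X \<omega>) \<omega>) \<bullet> b) \<omega> = 0) \<and>
        (AE \<omega> in M.
           real_cond_exp M H (\<lambda>\<omega>. (norm (g (X \<omega>) - G (X \<omega>) \<omega>))\<^sup>2) \<omega> \<le> \<sigma>\<^sup>2))"

datatype mfw_version = Convex_Min | Submodular_Max

fun regret ::
  "mfw_version \<Rightarrow> nat \<Rightarrow> 'a::euclidean_space set \<Rightarrow> (nat \<Rightarrow> 'a) \<Rightarrow> (nat \<Rightarrow> 'a) \<Rightarrow> real" where
  "regret Convex_Min T C d v =
     (\<Sum>t=1..T. d t \<bullet> v t) - (INF x\<in>C. \<Sum>t=1..T. d t \<bullet> x)"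
| "regret Submodular_Max T C d v =
     (SUP x\<in>C. \<Sum>t=1..T. d t \<bullet> x) - (\<Sum>t=1..T. d t \<bullet> v t)"

text \<open>An online algorithm maps the list of vectors fed so far to its next output, which makes
  it causal by construction. \<open>V\<close> is the set of vectors that may be fed. For \<open>V = UNIV\<close>
  the bound is required for all sequences of vectors. Since the last output does not depend on
  the last vector, whose scale is then arbitrary, this is satisfiable only if \<open>C\<close> is a
  singleton; hence the parameter.\<close>

definition linear_optimization_oracle ::
  "mfw_version \<Rightarrow> nat \<Rightarrow> 'a::euclidean_space set \<Rightarrow> 'a set \<Rightarrow> real \<Rightarrow> ('a list \<Rightarrow> 'a) \<Rightarrow> bool"
  where
  "linear_optimization_oracle ver T C V Reg A \<longleftrightarrow>
     (\<forall>ds. A ds \<in> C) \<and>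
     (\<forall>t\<in>{1..T}. (\<lambda>d. A (map d [1..<t])) \<in> borel_measurable (Pi\<^sub>M {1..<t} (\<lambda>_. borel))) \<and>
     (\<forall>d. (\<forall>t\<in>{1..T}. d t \<in> V) \<longrightarrow> regret ver T C d (\<lambda>t. A (map d [1..<t])) \<le> Reg)"

fun fw_step :: "mfw_version \<Rightarrow> real \<Rightarrow> 'a::euclidean_space \<Rightarrow> 'a \<Rightarrow> 'a" where
  "fw_step Convex_Min \<eta> x v = (1 - \<eta>) *\<^sub>R x + \<eta> *\<^sub>R v"
| "fw_step Submodular_Max \<eta> x v = x + \<eta> *\<^sub>R v"

text \<open>One realisation of the algorithm: \<open>A k\<close> is the \<open>k\<close>-th oracle, \<open>G t k\<close> answers the \<open>k\<close>-th
  gradient query of round \<open>t\<close>. The equations determine \<open>x\<close>, \<open>v\<close> and \<open>d\<close> on the relevant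
  indices. The point played in round \<open>t\<close> is \<open>x t (K + 1)\<close>.\<close>

definition meta_frank_wolfe ::
  "mfw_version \<Rightarrow> nat \<Rightarrow> nat \<Rightarrow> (nat \<Rightarrow> real) \<Rightarrow> (nat \<Rightarrow> real) \<Rightarrow> 'a::euclidean_space
    \<Rightarrow> (nat \<Rightarrow> 'a list \<Rightarrow> 'a) \<Rightarrow> (nat \<Rightarrow> nat \<Rightarrow> 'a \<Rightarrow> 'a)
    \<Rightarrow> (nat \<Rightarrow> nat \<Rightarrow> 'a) \<Rightarrow> (nat \<Rightarrow> nat \<Rightarrow> 'a) \<Rightarrow> (nat \<Rightarrow> nat \<Rightarrow> 'a) \<Rightarrow> bool" where
  "meta_frank_wolfe ver T K \<rho> \<eta> z A G x v d \<longleftrightarrow>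
     (\<forall>t\<in>{1..T}. d t 0 = 0 \<and> x t 1 = z \<and>
       (\<forall>k\<in>{1..K}.
          v t k = A k (map (\<lambda>s. d s k) [1..<t]) \<and>
          x t (k + 1) = fw_step ver (\<eta> k) (x t k) (v t k) \<and>
          d t k = (1 - \<rho> k) *\<^sub>R d t (k - 1) + \<rho> k *\<^sub>R G t k (x t k)))"

end

theory Submission
  imports Defs
begin

text \<open>Fix a comparator \<open>y\<close> in the constraint set. Both recursions are run pointwise: the suboptimality
  summed over the rounds contracts in every inner step \<open>k\<close>, up to the linear gap of the oracle output
  \<open>v t k\<close> with respect to the true gradients. Replacing these by the averaged estimates \<open>d t k\<close> bounds the
  gap by the regret plus the diameter times the estimation errors; only then expectations are taken. The
  mean squared error of the averaged estimates is \<open>O(k powr (-2/3))\<close>, because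
  unbiasedness removes the cross term between the old error and the new noise.

  In the submodular case the iterates move by vectors of length up to \<open>R\<close>, whereas the bound only
  allows the diameter \<open>D\<close>. Working with the derivative along each segment (an exact exponential decay)
  leaves a discretisation error \<open>L * R * D / K\<close>, and since \<open>L * R \<le> sqrt Q / 2\<close> this is absorbed by the
  slack in the sum of the inverse cube roots.\<close>

section \<open>One Frank-Wolfe step\<close>

text \<open>Each oracle controls its linear gap only summed over the rounds, so no recursion for a
  single \<open>f t\<close> is available; the rounds are summed first and the recursion runs in
  \<open>k\<close>. The oracle guarantee is deterministic and covers every feedback sequence in
  \<open>V\<close>, hence it applies pathwise however the feedback depends on the past. Conditioning
  on the past is possible because all iterates of a round are built from the feedback of earlier
  rounds: every query point of round \<open>t\<close> is known before its first query. The constants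
  in \<open>Q\<close> come from an induction with the ansatz \<open>Q / (k + 4) powr (2/3)\<close>
  for the mean squared error. Its start \<open>k = 0\<close> requires \<open>4 powr (2/3)\<close>
  times the squared initial gradient. Its step requires \<open>4 * \<sigma>\<^sup>2 + B\<close>,
  where \<open>B\<close> bounds \<open>(k + 3) * (k + 2)\<close> times the squared change of the
  gradient from iterate \<open>k - 1\<close> to \<open>k\<close>. There is no such change at
  \<open>k = 1\<close>; the worst case \<open>k = 2\<close> has the ratio 5/4, at most 3/2, in the
  convex version and, with \<open>K = 2\<close>, the ratio 5, at most 6, in the submodular
  one.\<close>

lemma segment_derivative:
  fixes f :: "'a::euclidean_space \<Rightarrow> real"
  assumes "has_gradient_on f g S" "convex S" "x \<in> S" "x + h \<in> S" "s \<in> {0..1}"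
  shows "((\<lambda>s. f (x + s *\<^sub>R h)) has_real_derivative g (x + s *\<^sub>R h) \<bullet> h) (at s within {0..1})"
    and "x + s *\<^sub>R h \<in> S"
proof -
  have seg: "x + r *\<^sub>R h \<in> S" if "r \<in> {0..1}" for r
  proof -
    have "(1 - r) *\<^sub>R x + r *\<^sub>R (x + h) \<in> S"
      using that assms by (intro convexD) auto
    thus ?thesis by (simp add: algebra_simps)
  qed
  show "x + s *\<^sub>R h \<in> S" using seg assms(5) by blast
  have "(f has_derivative (\<lambda>y. g (x + s *\<^sub>R h) \<bullet> y)) (at (x + s *\<^sub>R h) within S)"
    using assms(1,5) seg by (auto simp: has_gradient_on_def)
  \<comment> \<open>The gradient is a derivative within \<open>S\<close> only. Restricting further
    to the image of the segment lets the chain rule apply at boundary points too, with one-sided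
    derivatives at the two ends.\<close>
  hence f: "(f has_derivative (\<lambda>y. g (x + s *\<^sub>R h) \<bullet> y))
      (at (x + s *\<^sub>R h) within (\<lambda>s. x + s *\<^sub>R h) ` {0..1})"
    by (rule has_derivative_subset) (use seg in auto)
  have "((\<lambda>s. x + s *\<^sub>R h) has_derivative (\<lambda>r. r *\<^sub>R h)) (at s within {0..1})"
    by (auto intro!: derivative_eq_intros)
  from has_derivative_in_compose[OF this f]
  show "((\<lambda>s. f (x + s *\<^sub>R h)) has_real_derivative g (x + s *\<^sub>R h) \<bullet> h) (at s within {0..1})"
    by (simp add: has_field_derivative_def mult_commute_abs)
qed

lemma gradient_mean_value:
  fixes f :: "'a::euclidean_space \<Rightarrow> real"
  assumes "has_gradient_on f g S" "convex S" "x \<in> S" "x + h \<in> S"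
  obtains s where "s \<in> {0..1}" "x + s *\<^sub>R h \<in> S" "f (x + h) - f x = g (x + s *\<^sub>R h) \<bullet> h"
proof -
  have "\<exists>s\<in>{0..1}. f (x + 1 *\<^sub>R h) - f (x + 0 *\<^sub>R h) = (1 - 0) * (g (x + s *\<^sub>R h) \<bullet> h)"
    using mvt_very_simple[of 0 1 "\<lambda>s. f (x + s *\<^sub>R h)" "\<lambda>s r. r * (g (x + s *\<^sub>R h) \<bullet> h)"]
      segment_derivative(1)[OF assms]
    by (simp add: has_field_derivative_def mult_commute_abs)
  with that segment_derivative(2)[OF assms] show ?thesis by auto
qed

text \<open>If the inequality failed, \<open>f\<close> along the segment minus
  \<open>s * (f y - f x)\<close> would have a positive right derivative at 0 and exceed
  \<open>f x\<close> for some small \<open>h\<close>, against the chord bound.\<close>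

lemma convex_gradient_inequality:
  fixes f :: "'a::euclidean_space \<Rightarrow> real"
  assumes "has_gradient_on f g S" "convex_on S f" "x \<in> S" "y \<in> S"
  shows "f x + g x \<bullet> (y - x) \<le> f y"
proof (rule ccontr)
  assume "\<not> ?thesis"
  hence pos: "g x \<bullet> (y - x) - (f y - f x) > 0" by simp
  have S: "convex S" using assms(2) by (rule convex_on_imp_convex)
  have "((\<lambda>s. f (x + s *\<^sub>R (y - x)) - s * (f y - f x)) has_real_derivative
      g x \<bullet> (y - x) - (f y - f x)) (at 0 within {0..1})"
    using segment_derivative(1)[OF assms(1) S assms(3), of "y - x" 0] assms(4)
    by (auto intro!: derivative_eq_intros)
  from has_real_derivative_pos_inc_right[OF this pos] obtain e where e: "e > 0" and
    inc: "\<And>h. h > 0 \<Longrightarrow> h \<in> {0..1} \<Longrightarrow> h < e \<Longrightarrow>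
      f x < f (x + h *\<^sub>R (y - x)) - h * (f y - f x)"
    by auto
  define h where "h = min (e / 2) 1"
  have h: "0 < h" "h \<le> 1" "h < e" using e by (auto simp: h_def)
  have "f (x + h *\<^sub>R (y - x)) = f ((1 - h) *\<^sub>R x + h *\<^sub>R y)" by (simp add: algebra_simps)
  also have "\<dots> \<le> (1 - h) * f x + h * f y"
    using assms h by (intro convex_onD) auto
  finally show False using inc[of h] h by (simp add: algebra_simps)
qed

text \<open>Mean value theorem plus Lipschitz bound; the convexity inequality then trades
  \<open>g x \<bullet> (y - x)\<close> for \<open>f y - f x\<close>. Integrating along the segment
  would halve \<open>L * D\<^sup>2\<close>, but the theorem allows even 4/3 of it in front of the
  logarithm.\<close>

lemma convex_frank_wolfe_step:
  fixes f :: "'a::euclidean_space \<Rightarrow> real"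
  assumes "smooth_on L f g S" "convex_on S f" "x \<in> S" "y \<in> S" "v \<in> S" "0 \<le> \<eta>" "\<eta> \<le> 1"
    and "norm (v - x) \<le> D"
  shows "f ((1 - \<eta>) *\<^sub>R x + \<eta> *\<^sub>R v) - f y
    \<le> (1 - \<eta>) * (f x - f y) + \<eta> * (g x \<bullet> (v - y)) + \<eta>\<^sup>2 * (L * D\<^sup>2)"
proof -
  have g: "has_gradient_on f g S" and lip: "L-lipschitz_on S g"
    using assms(1) by (auto simp: smooth_on_def)
  have L: "0 \<le> L" using lip by (rule lipschitz_on_nonneg)
  have S: "convex S" using assms(2) by (rule convex_on_imp_convex)
  define h where "h = \<eta> *\<^sub>R (v - x)"
  have eq: "x + h = (1 - \<eta>) *\<^sub>R x + \<eta> *\<^sub>R v" by (simp add: h_def algebra_simps)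
  have "x + h \<in> S" unfolding eq using assms S by (intro convexD) auto
  then obtain s where s: "s \<in> {0..1}" "x + s *\<^sub>R h \<in> S" "f (x + h) - f x = g (x + s *\<^sub>R h) \<bullet> h"
    using gradient_mean_value[OF g S assms(3)] by blast
  have "(g (x + s *\<^sub>R h) - g x) \<bullet> h \<le> norm (g (x + s *\<^sub>R h) - g x) * norm h"
    by (rule norm_cauchy_schwarz)
  also have "\<dots> \<le> (L * norm h) * norm h"
  proof (rule mult_right_mono)
    have "norm (g (x + s *\<^sub>R h) - g x) \<le> L * norm (s *\<^sub>R h)"
      using lipschitz_onD[OF lip s(2) assms(3)] by (simp add: dist_norm)
    also have "\<dots> \<le> L * norm h" using s(1) L by (auto intro!: mult_left_mono mult_left_le_one_le)
    finally show "norm (g (x + s *\<^sub>R h) - g x) \<le> L * norm h" .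
  qed simp
  also have "\<dots> = \<eta>\<^sup>2 * (L * (norm (v - x))\<^sup>2)"
    using assms(6) by (simp add: h_def power2_eq_square)
  also have "\<dots> \<le> \<eta>\<^sup>2 * (L * D\<^sup>2)"
    using assms(8) L by (intro mult_left_mono power_mono) auto
  finally have 1: "f (x + h) - f x \<le> g x \<bullet> h + \<eta>\<^sup>2 * (L * D\<^sup>2)"
    using s(3) by (simp add: inner_diff_left)
  have "\<eta> * (g x \<bullet> (y - x)) \<le> \<eta> * (f y - f x)"
    using convex_gradient_inequality[OF g assms(2,3,4)] assms(6) by (intro mult_left_mono) auto
  with 1 show ?thesis unfolding eq[symmetric]
    by (simp add: h_def algebra_simps inner_simps)
qed

section \<open>Monotone DR-submodular functions on a box\<close>

lemma box_convex:
  fixes I :: "'n::finite \<Rightarrow> real set"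
  assumes "\<And>i. is_interval (I i)"
  shows "convex {y :: real ^ 'n. \<forall>i. y $ i \<in> I i}"
  using assms by (auto simp: is_interval_convex_1 convex_def)

text \<open>Such functions are concave only along nonnegative directions, so the path from
  \<open>x\<close> to \<open>y\<close> is replaced by one through the join. With \<open>w\<close>
  the meet and \<open>u = y - w\<close>, the join is \<open>x + u\<close>: monotonicity gives
  \<open>f y \<le> f (x + u)\<close>, the antitone gradient bounds the gain along \<open>u\<close>
  by \<open>g x \<bullet> u\<close>, and \<open>g x \<bullet> w\<close> is nonnegative.\<close>

lemma dr_submodular_gradient_inequality:
  fixes f :: "real ^ 'n \<Rightarrow> real"
  assumes S: "S = {y. \<forall>i. y $ i \<in> I i}" "\<And>i. is_interval (I i)" "\<And>i. 0 \<in> I i" "\<And>i. I i \<subseteq> {0..}"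
    and "dr_submodular_on f g S" "mono_on S f" "x \<in> S" "y \<in> S"
  shows "f y - f x \<le> g x \<bullet> y"
proof -
  have grad: "has_gradient_on f g S"
    and anti: "\<And>a b. a \<in> S \<Longrightarrow> b \<in> S \<Longrightarrow> a \<le> b \<Longrightarrow> g b \<le> g a"
    using assms(5) by (auto simp: dr_submodular_on_def)
  \<comment> \<open>Each factor is an interval containing 0, so the box is down-closed in the
    orthant, a property that the feasible set itself may lack.\<close>
  have between: "a \<in> S" if "\<And>i. 0 \<le> a $ i" "\<And>i. a $ i \<le> max (x $ i) (y $ i)" for a
    unfolding S(1)
  proof safe
    fix i
    have "max (x $ i) (y $ i) \<in> I i" using assms(7,8) by (auto simp: S(1) max_def)
    thus "a $ i \<in> I i" using that[of i] S(2,3)[of i] by (meson mem_is_interval_1_I)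
  qed
  have nonneg: "0 \<le> x $ i" "0 \<le> y $ i" for i using assms(7,8) S(1,4) by auto
  have cS: "convex S" unfolding S(1) using S(2) by (rule box_convex)
  define w where "w = (\<chi> i. min (x $ i) (y $ i))"
  define u where "u = y - w"
  have u: "u $ i = max (x $ i) (y $ i) - x $ i" for i by (simp add: u_def w_def)
  have u0: "0 \<le> u $ i" for i by (simp add: u)
  have xu: "x + u \<in> S" using nonneg by (intro between) (auto simp: u le_max_iff_disj)
  have "f y \<le> f (x + u)"
    using assms(8) xu by (intro mono_onD[OF assms(6)]) (auto simp: less_eq_vec_def u)
  moreover have "f (x + u) - f x \<le> g x \<bullet> u"
  proof -
    obtain s where s: "s \<in> {0..1}" "x + s *\<^sub>R u \<in> S" "f (x + u) - f x = g (x + s *\<^sub>R u) \<bullet> u"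
      using gradient_mean_value[OF grad cS assms(7) xu] by blast
    have "g (x + s *\<^sub>R u) \<le> g x"
      using s u0 assms(7) by (intro anti) (auto simp: less_eq_vec_def)
    hence "g (x + s *\<^sub>R u) \<bullet> u \<le> g x \<bullet> u"
      using u0 by (auto simp: inner_vec_def less_eq_vec_def intro!: sum_mono mult_right_mono)
    thus ?thesis using s by simp
  qed
  \<comment> \<open>The gradient need not be nonnegative in coordinates where the box is degenerate; monotonicity
    is therefore used in the direction of the meet \<open>w\<close>, which stays inside the box.\<close>
  moreover have "0 \<le> g x \<bullet> w"
  proof (rule ccontr)
    assume "\<not> ?thesis"
    hence pos: "g x \<bullet> (- w) > 0" by simp
    have seg: "x + s *\<^sub>R (- w) \<in> S" if "s \<in> {0..1}" for s
    proof (rule between)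
      fix i
      have "0 \<le> w $ i" using nonneg by (simp add: w_def)
      hence "s * w $ i \<le> w $ i" "0 \<le> s * w $ i"
        using that by (auto intro: mult_left_le_one_le)
      moreover have "w $ i \<le> x $ i" "x $ i \<le> max (x $ i) (y $ i)" by (simp_all add: w_def)
      ultimately show "0 \<le> (x + s *\<^sub>R (- w)) $ i" "(x + s *\<^sub>R (- w)) $ i \<le> max (x $ i) (y $ i)"
        by (simp_all only: vector_add_component vector_scaleR_component vector_uminus_component
            scaleR_minus_right real_scaleR_def mult_minus_right)
    qed
    have "((\<lambda>s. f (x + s *\<^sub>R (- w))) has_real_derivative g x \<bullet> (- w)) (at 0 within {0..1})"
      using segment_derivative(1)[OF grad cS assms(7), of "- w" 0] seg[of 1] by simp
    from has_real_derivative_pos_inc_right[OF this pos] obtain e where e: "e > 0" and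
      inc: "\<And>h. h > 0 \<Longrightarrow> h \<in> {0..1} \<Longrightarrow> h < e \<Longrightarrow> f x < f (x + h *\<^sub>R (- w))"
      by auto
    define h where "h = min (e / 2) 1"
    have h: "0 < h" "h \<in> {0..1}" "h < e" using e by (auto simp: h_def)
    have "f (x + h *\<^sub>R (- w)) \<le> f x"
      using h nonneg by (intro mono_onD[OF assms(6)] seg assms(7)) (auto simp: less_eq_vec_def w_def)
    thus False using inc[OF h] by simp
  qed
  ultimately show ?thesis by (simp add: u_def inner_diff_right)
qed

text \<open>Gronwall with the integrating factor \<open>exp (\<eta> * s)\<close>:
  \<open>?\<phi>\<close> is nonincreasing. The exact factor \<open>exp (- \<eta>)\<close>, in place
  of the \<open>1 - \<eta>\<close> of a discrete step, makes \<open>K\<close> steps of length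
  \<open>1 / K\<close> contract by \<open>exp (- 1)\<close>.\<close>

lemma relaxation_decay:
  fixes \<psi> \<psi>' :: "real \<Rightarrow> real"
  assumes "\<And>s. s \<in> {0..1} \<Longrightarrow> (\<psi> has_real_derivative \<psi>' s) (at s within {0..1})"
    and "\<And>s. s \<in> {0..1} \<Longrightarrow> \<psi>' s \<le> \<eta> * (c - \<psi> s)"
  shows "\<psi> 1 \<le> exp (- \<eta>) * \<psi> 0 + (1 - exp (- \<eta>)) * c"
proof -
  let ?\<phi> = "\<lambda>s. exp (\<eta> * s) * (\<psi> s - c)"
  let ?D = "\<lambda>s. exp (\<eta> * s) * (\<psi>' s - \<eta> * (c - \<psi> s))"
  have "(?\<phi> has_real_derivative ?D s) (at s within {0..1})" if "s \<in> {0..1}" for s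
    by (rule derivative_eq_intros assms(1)[OF that] refl | simp add: algebra_simps)+
  then obtain s where s: "s \<in> {0..1}" "?\<phi> 1 - ?\<phi> 0 = ?D s"
    using mvt_very_simple[of 0 1 ?\<phi> "\<lambda>s r. ?D s * r"] by (auto simp: has_field_derivative_def)
  have "?D s \<le> 0" using assms(2)[OF s(1)] by (simp add: mult_le_0_iff)
  hence "exp \<eta> * (\<psi> 1 - c) \<le> \<psi> 0 - c" using s(2) by simp
  hence "exp (- \<eta>) * (exp \<eta> * (\<psi> 1 - c)) \<le> exp (- \<eta>) * (\<psi> 0 - c)"
    by (intro mult_left_mono) auto
  moreover have "exp (- \<eta>) * (exp \<eta> * (\<psi> 1 - c)) = \<psi> 1 - c"
    by (simp add: mult.assoc[symmetric] exp_add[symmetric])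
  ultimately show ?thesis by (simp add: algebra_simps)
qed

text \<open>Comparing the derivative along the whole segment with the gradient at its starting point costs
  \<open>L * \<eta> * norm v * norm (v - y)\<close>; the one-step estimate by smoothness would instead cost
  \<open>L * \<eta> * (norm v)\<^sup>2\<close>, which the bound in terms of the diameter does not allow.\<close>

lemma dr_submodular_frank_wolfe_step:
  fixes f :: "real ^ 'n \<Rightarrow> real"
  assumes S: "S = {y. \<forall>i. y $ i \<in> I i}" "\<And>i. is_interval (I i)" "\<And>i. 0 \<in> I i" "\<And>i. I i \<subseteq> {0..}"
    and dr: "dr_submodular_on f g S" "mono_on S f"
    and lip: "L-lipschitz_on S g"
    and "x \<in> S" "y \<in> S" "x + \<eta> *\<^sub>R v \<in> S" "0 \<le> \<eta>" "norm v \<le> R" "norm (v - y) \<le> D"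
  shows "f y - f (x + \<eta> *\<^sub>R v)
    \<le> exp (- \<eta>) * (f y - f x) + (1 - exp (- \<eta>)) * (g x \<bullet> (y - v) + \<eta> * (L * R * D))"
proof -
  let ?p = "\<lambda>s. x + s *\<^sub>R (\<eta> *\<^sub>R v)"
  have L: "0 \<le> L" using lip by (rule lipschitz_on_nonneg)
  have grad: "has_gradient_on f g S" using dr by (simp add: dr_submodular_on_def)
  have cS: "convex S" unfolding S(1) using S(2) by (rule box_convex)
  have pS: "?p s \<in> S" if "s \<in> {0..1}" for s
    using segment_derivative(2)[OF grad cS assms(8,10) that] .
  have "f y - f (?p 1) \<le> exp (- \<eta>) * (f y - f (?p 0))
      + (1 - exp (- \<eta>)) * (g x \<bullet> (y - v) + \<eta> * (L * R * D))"
  proof (rule relaxation_decay)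
    fix s :: real assume s: "s \<in> {0..1}"
    show "((\<lambda>s. f y - f (?p s)) has_real_derivative - (g (?p s) \<bullet> (\<eta> *\<^sub>R v))) (at s within {0..1})"
      using segment_derivative(1)[OF grad cS assms(8,10) s]
      by (auto intro!: derivative_eq_intros)
    \<comment> \<open>The gradient inequality is used at the moving point \<open>?p s\<close>, so
      the change of the gradient is paired with \<open>y - v\<close> and not with \<open>v\<close>:
      the displacement contributes the factor \<open>R\<close>, the pairing the factor
      \<open>D\<close>.\<close>
    have "(g (?p s) - g x) \<bullet> (y - v) \<le> norm (g (?p s) - g x) * norm (v - y)"
      by (metis norm_cauchy_schwarz norm_minus_commute)
    also have "\<dots> \<le> (\<eta> * (L * R)) * D"
    proof (rule mult_mono)
      have "norm (g (?p s) - g x) \<le> L * norm (s *\<^sub>R (\<eta> *\<^sub>R v))"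
        using lipschitz_onD[OF lip pS[OF s] assms(8)] by (simp add: dist_norm)
      also have "\<dots> \<le> L * (1 * (\<eta> * R))"
        using s assms(11,12) L
        by (simp only: norm_scaleR, intro mult_left_mono mult_mono) auto
      finally show "norm (g (?p s) - g x) \<le> \<eta> * (L * R)" by (simp add: mult_ac)
    qed (use L assms(11) order_trans[OF norm_ge_zero assms(12)] assms(13) in auto)
    finally have "g (?p s) \<bullet> (y - v) \<le> g x \<bullet> (y - v) + \<eta> * (L * R * D)"
      by (simp add: inner_diff_left mult_ac)
    moreover have "f y - f (?p s) \<le> g (?p s) \<bullet> y"
      using dr_submodular_gradient_inequality[OF S dr pS[OF s] assms(9)] .
    ultimately have "- (g (?p s) \<bullet> v) \<le> g x \<bullet> (y - v) + \<eta> * (L * R * D) - (f y - f (?p s))"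
      by (simp add: inner_diff_right)
    from mult_left_mono[OF this assms(11)]
    show "- (g (?p s) \<bullet> (\<eta> *\<^sub>R v)) \<le> \<eta> * (g x \<bullet> (y - v) + \<eta> * (L * R * D) - (f y - f (?p s)))"
      by simp
  qed
  thus ?thesis by simp
qed

section \<open>Variance reduction by averaging\<close>

lemma powr_thirds:
  fixes m :: real
  assumes "0 < m"
  shows "(m powr (1/3)) ^ 3 = m" "m powr (2/3) = (m powr (1/3))\<^sup>2" "(m powr (2/3)) ^ 3 = m\<^sup>2"
  using assms by (simp_all add: powr_power)

text \<open>The term \<open>1 / k powr (1/3)\<close> is at most the increment of
  \<open>3/2 * k powr (2/3)\<close> from \<open>k - 1\<close> to \<open>k\<close>, so the sum
  telescopes. The \<open>1/2\<close> is gained in the base case, where the first term is bounded by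
  \<open>1 = 3/2 - 1/2\<close>.\<close>

lemma sum_inverse_cube_root_le:
  assumes "1 \<le> K"
  shows "(\<Sum>k=1..K. 1 / (real k + 4) powr (1/3)) \<le> 3/2 * real K powr (2/3) - 1/2"
  using assms
proof (induction K rule: nat_induct_at_least)
  case base
  have "1 \<le> (1 + 4 :: real) powr (1/3)" by (intro ge_one_powr_ge_zero) auto
  thus ?case by (simp add: divide_le_eq)
next
  case (Suc n)
  define a b where "a = real (Suc n) powr (1/3)" and "b = real n powr (1/3)"
  have n: "0 < real n" "0 < real (Suc n)" using Suc.hyps by auto
  have pos: "0 < b" "b \<le> a" using n by (auto simp: a_def b_def intro!: powr_mono2)
  have cubes: "a ^ 3 - b ^ 3 = 1"
    using powr_thirds(1)[OF n(1)] powr_thirds(1)[OF n(2)] by (simp add: a_def b_def)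
  have "1 / (real (Suc n) + 4) powr (1/3) \<le> 1 / a"
    unfolding a_def by (intro divide_left_mono powr_mono2 mult_pos_pos) auto
  also have "1 / a \<le> 3/2 * (a\<^sup>2 - b\<^sup>2)"
  proof -
    \<comment> \<open>This product is the difference of the two sides of the next inequality, whose
      left side is 1 by \<open>cubes\<close>.\<close>
    have "0 \<le> (a - b)\<^sup>2 * (a / 2 + b) * 1"
      using pos by auto
    hence "a ^ 3 - b ^ 3 \<le> a * (3/2 * (a\<^sup>2 - b\<^sup>2))"
      by (simp add: power2_eq_square power3_eq_cube algebra_simps)
    thus ?thesis using cubes pos by (simp add: divide_le_eq mult.commute)
  qed
  also have "\<dots> = 3/2 * real (Suc n) powr (2/3) - 3/2 * real n powr (2/3)"
    using powr_thirds(2)[OF n(1)] powr_thirds(2)[OF n(2)] by (simp add: a_def b_def)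
  finally show ?case using Suc by simp
qed

text \<open>The factor \<open>2 / r - 1\<close> instead of the simpler \<open>2 / r\<close> is what allows \<open>m\<^sup>2 - m\<close> instead of
  \<open>m\<^sup>2\<close> in the condition on the drift \<open>\<delta>\<close>; with \<open>m\<^sup>2\<close> the constants of the theorem fail at the second step.\<close>

lemma momentum_recursion:
  fixes m :: real
  assumes "4 \<le> m" "r = 2 / m powr (2/3)" "\<Delta> \<le> Q / m powr (2/3)"
    and "(m\<^sup>2 - m) * \<delta> \<le> B" "4 * \<sigma>\<^sup>2 + B \<le> Q" "0 \<le> \<delta>" "0 \<le> Q"
  shows "(1 - r) * \<Delta> + (2 / r - 1) * \<delta> + r\<^sup>2 * \<sigma>\<^sup>2 \<le> Q / (m + 1) powr (2/3)"
    and "0 < r" "r \<le> 1"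
proof -
  define u w where "u = m powr (2/3)" and "w = (m + 1) powr (2/3)"
  have u3: "u ^ 3 = m\<^sup>2" "w ^ 3 = (m + 1)\<^sup>2"
    using assms(1) by (simp_all add: u_def w_def powr_thirds(3))
  have w0: "0 < w" using assms(1) by (simp add: w_def)
  have u2: "2 \<le> u"
  proof (rule ccontr)
    assume "\<not> 2 \<le> u"
    hence "u ^ 3 < 2 ^ 3" by (intro power_strict_mono) (auto simp: u_def)
    moreover have "(4::real)\<^sup>2 \<le> m\<^sup>2" using assms(1) by (intro power_mono) auto
    ultimately show False using u3 by simp
  qed
  have um: "m \<le> u\<^sup>2"
  proof -
    have "m powr 1 \<le> m powr (4/3)" using assms(1) by (intro powr_mono) auto
    thus ?thesis using assms(1) by (simp add: u_def powr_power)
  qed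
  \<comment> \<open>Comparison of cubes: \<open>(m + 1)\<^sup>2\<close> against
    \<open>(u + 1) ^ 3\<close>, where \<open>3 * u\<^sup>2\<close> pays for
    \<open>2 * m\<close>.\<close>
  have wu: "w \<le> u + 1"
  proof (rule power_le_imp_le_base)
    have "w ^ 3 \<le> u ^ 3 + 3 * u\<^sup>2 + 3 * u + 1"
      using u3 um u2 assms(1) by (simp add: power2_eq_square algebra_simps)
    thus "w ^ Suc 2 \<le> (u + 1) ^ Suc 2"
      by (simp add: numeral_eq_Suc algebra_simps)
  qed (use u2 in auto)
  have r: "r = 2 / u" using assms(2) by (simp add: u_def)
  show "0 < r" "r \<le> 1" using u2 by (auto simp: r)
  have "(1 - r) * \<Delta> \<le> (1 - r) * (Q / u)"
    using assms(3) u2 by (intro mult_left_mono) (auto simp: r u_def[symmetric])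
  also have "\<dots> = (u - 2) * Q / u\<^sup>2"
    using u2 by (simp add: r field_simps power2_eq_square)
  finally have 1: "(1 - r) * \<Delta> \<le> (u - 2) * Q / u\<^sup>2" .
  \<comment> \<open>In terms of \<open>u\<close> the factor \<open>2 / r - 1\<close> is
    \<open>u - 1\<close>, and \<open>u ^ 3 = m\<^sup>2\<close>; this produces the weight
    \<open>m\<^sup>2 - m\<close>.\<close>
  have "u\<^sup>2 * ((u - 1) * \<delta>) = (u ^ 3 - u\<^sup>2) * \<delta>"
    by (simp add: power2_eq_square power3_eq_cube algebra_simps)
  also have "\<dots> \<le> (m\<^sup>2 - m) * \<delta>"
    using um u3 assms(6) by (intro mult_right_mono) auto
  finally have "u\<^sup>2 * ((u - 1) * \<delta>) \<le> B" using assms(4) by linarith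
  hence 2: "(2 / r - 1) * \<delta> \<le> B / u\<^sup>2"
    using u2 by (simp add: r field_simps)
  have 3: "r\<^sup>2 * \<sigma>\<^sup>2 = 4 * \<sigma>\<^sup>2 / u\<^sup>2" by (simp add: r power_divide)
  \<comment> \<open>The contraction leaves \<open>u - 2\<close> copies of \<open>Q\<close>; drift
    and noise together cost one more. Then \<open>(u - 1) * (u + 1) \<le> u\<^sup>2\<close> and
    \<open>w \<le> u + 1\<close> finish.\<close>
  have "(1 - r) * \<Delta> + (2 / r - 1) * \<delta> + r\<^sup>2 * \<sigma>\<^sup>2 \<le> ((u - 2) * Q + B + 4 * \<sigma>\<^sup>2) / u\<^sup>2"
    using 1 2 3 by (simp add: add_divide_distrib)
  also have "\<dots> \<le> ((u - 1) * Q) / u\<^sup>2"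
    using assms(5) by (intro divide_right_mono) (auto simp: algebra_simps)
  also have "\<dots> \<le> Q / (u + 1)"
  proof -
    have "(u - 1) * (u + 1) * Q \<le> u\<^sup>2 * Q"
      using assms(7) by (intro mult_right_mono) (auto simp: algebra_simps power2_eq_square)
    thus ?thesis using u2 by (simp add: divide_simps mult_ac)
  qed
  also have "\<dots> \<le> Q / w"
    using wu w0 assms(7) by (intro divide_left_mono) auto
  finally show "(1 - r) * \<Delta> + (2 / r - 1) * \<delta> + r\<^sup>2 * \<sigma>\<^sup>2 \<le> Q / (m + 1) powr (2/3)"
    by (simp add: w_def)
qed

text \<open>Young's inequality with weight \<open>r / 2\<close> inflates the old error by
  \<open>1 + r / 2\<close>, which one of the two factors \<open>1 - r\<close> absorbs. For
  \<open>q\<close>, one factor is dropped and the other kept: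
  \<open>(1 - r) * (1 + 2 / r) = 2 / r - 1 - r\<close>.\<close>

lemma norm_momentum_error_le:
  fixes p q :: "'a::real_inner"
  assumes "0 < r" "r \<le> 1"
  shows "(norm ((1 - r) *\<^sub>R (p + q)))\<^sup>2 \<le> (1 - r) * (norm p)\<^sup>2 + (2 / r - 1) * (norm q)\<^sup>2"
proof -
  define s where "s = 1 - r"
  have s: "0 \<le> s" "s \<le> 1" using assms by (auto simp: s_def)
  have "0 \<le> (norm (r *\<^sub>R p - 2 *\<^sub>R q))\<^sup>2 / (2 * r)" using assms by simp
  also have "\<dots> = (r / 2) * (norm p)\<^sup>2 - 2 * (p \<bullet> q) + (2 / r) * (norm q)\<^sup>2"
    using assms unfolding power2_norm_eq_inner
    by (simp add: inner_simps inner_commute field_simps power2_eq_square)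
  finally have "(norm (p + q))\<^sup>2 \<le> (1 + r / 2) * (norm p)\<^sup>2 + (1 + 2 / r) * (norm q)\<^sup>2"
    unfolding power2_norm_eq_inner by (simp add: inner_simps inner_commute algebra_simps)
  hence "s\<^sup>2 * (norm (p + q))\<^sup>2 \<le> s\<^sup>2 * ((1 + r / 2) * (norm p)\<^sup>2 + (1 + 2 / r) * (norm q)\<^sup>2)"
    by (intro mult_left_mono) auto
  also have "\<dots> = (s\<^sup>2 * (1 + r / 2)) * (norm p)\<^sup>2 + (s\<^sup>2 * (1 + 2 / r)) * (norm q)\<^sup>2"
    by (simp add: algebra_simps)
  also have "\<dots> \<le> s * (norm p)\<^sup>2 + (2 / r - 1) * (norm q)\<^sup>2"
  proof (intro add_mono mult_right_mono)
    have "s * (s * (1 + r / 2)) \<le> s * 1"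
      using s assms by (intro mult_left_mono) (auto simp: s_def algebra_simps)
    thus "s\<^sup>2 * (1 + r / 2) \<le> s" by (simp add: power2_eq_square)
    have "s * (s * (1 + 2 / r)) \<le> 1 * (s * (1 + 2 / r))"
      using s assms by (intro mult_right_mono) auto
    also have "\<dots> = 2 / r - 1 - r" using assms by (simp add: s_def field_simps)
    finally show "s\<^sup>2 * (1 + 2 / r) \<le> 2 / r - 1" using assms by (simp add: power2_eq_square)
  qed auto
  finally show ?thesis by (simp add: s_def power_mult_distrib)
qed

text \<open>Being known before the query, \<open>u\<close> can be pulled out of the conditional
  expectation, so its pairing with the noise integrates to 0. The query point \<open>X\<close> may
  be random, but it is known in \<open>H\<close> as well.\<close>

lemma stochastic_gradient_query_square:
  fixes u :: "'w \<Rightarrow> 'a::euclidean_space"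
  assumes "prob_space M" "subalgebra M H" and q: "stochastic_gradient_query M H S g \<sigma> G"
    and X: "X \<in> borel_measurable H" "\<And>\<omega>. \<omega> \<in> space M \<Longrightarrow> X \<omega> \<in> S"
    and gX: "(\<lambda>\<omega>. g (X \<omega>)) \<in> borel_measurable M"
    and u: "u \<in> borel_measurable H" "integrable M (\<lambda>\<omega>. (norm (u \<omega>))\<^sup>2)"
  shows "integrable M (\<lambda>\<omega>. (norm (u \<omega> + r *\<^sub>R (g (X \<omega>) - G (X \<omega>) \<omega>)))\<^sup>2)"
    and "(\<integral>\<omega>. (norm (u \<omega> + r *\<^sub>R (g (X \<omega>) - G (X \<omega>) \<omega>)))\<^sup>2 \<partial>M)
      \<le> (\<integral>\<omega>. (norm (u \<omega>))\<^sup>2 \<partial>M) + r\<^sup>2 * \<sigma>\<^sup>2"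
proof -
  interpret prob_space M by fact
  interpret finite_measure_subalgebra M H
    by unfold_locales fact
  define e where "e \<omega> = g (X \<omega>) - G (X \<omega>) \<omega>" for \<omega>
  have GX: "(\<lambda>\<omega>. G (X \<omega>) \<omega>) \<in> borel_measurable M"
    and e2: "integrable M (\<lambda>\<omega>. (norm (e \<omega>))\<^sup>2)"
    and mean: "\<And>b. b \<in> Basis \<Longrightarrow> AE \<omega> in M. real_cond_exp M H (\<lambda>\<omega>. e \<omega> \<bullet> b) \<omega> = 0"
    and var: "AE \<omega> in M. real_cond_exp M H (\<lambda>\<omega>. (norm (e \<omega>))\<^sup>2) \<omega> \<le> \<sigma>\<^sup>2"
    using q X by (auto simp: stochastic_gradient_query_def e_def)
  have em: "e \<in> borel_measurable M" unfolding e_def using GX gX by measurable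
  have um: "u \<in> borel_measurable M" using measurable_from_subalg[OF assms(2) u(1)] .
  \<comment> \<open>Conditional unbiasedness is given coordinatewise, so the inner product is split
    along \<open>Basis\<close>; each product is dominated by the sum of the two squares.\<close>
  have prod: "integrable M (\<lambda>\<omega>. (u \<omega> \<bullet> b) * (e \<omega> \<bullet> b))"
    and zero: "(\<integral>\<omega>. (u \<omega> \<bullet> b) * (e \<omega> \<bullet> b) \<partial>M) = 0" if b: "b \<in> Basis" for b
  proof -
    show int: "integrable M (\<lambda>\<omega>. (u \<omega> \<bullet> b) * (e \<omega> \<bullet> b))"
    proof (rule Bochner_Integration.integrable_bound[OF Bochner_Integration.integrable_add[OF u(2) e2]])
      show "(\<lambda>\<omega>. (u \<omega> \<bullet> b) * (e \<omega> \<bullet> b)) \<in> borel_measurable M" using um em by measurable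
      show "AE \<omega> in M. norm ((u \<omega> \<bullet> b) * (e \<omega> \<bullet> b)) \<le> norm ((norm (u \<omega>))\<^sup>2 + (norm (e \<omega>))\<^sup>2)"
      proof (rule AE_I2)
        fix \<omega>
        have "\<bar>u \<omega> \<bullet> b\<bar> * \<bar>e \<omega> \<bullet> b\<bar> \<le> norm (u \<omega>) * norm (e \<omega>)"
          using b by (intro mult_mono Basis_le_norm) auto
        also have "\<dots> \<le> (norm (u \<omega>))\<^sup>2 + (norm (e \<omega>))\<^sup>2"
          using sum_squares_bound[of "norm (u \<omega>)" "norm (e \<omega>)"]
            mult_nonneg_nonneg[OF norm_ge_zero[of "u \<omega>"] norm_ge_zero[of "e \<omega>"]] by linarith
        finally show "norm ((u \<omega> \<bullet> b) * (e \<omega> \<bullet> b)) \<le> norm ((norm (u \<omega>))\<^sup>2 + (norm (e \<omega>))\<^sup>2)"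
          by (simp add: abs_mult)
      qed
    qed
    have "(\<integral>\<omega>. (u \<omega> \<bullet> b) * (e \<omega> \<bullet> b) \<partial>M)
        = (\<integral>\<omega>. (u \<omega> \<bullet> b) * real_cond_exp M H (\<lambda>\<omega>. e \<omega> \<bullet> b) \<omega> \<partial>M)"
      using real_cond_exp_intg(2)[OF int] u(1) em by simp
    also have "\<dots> = (\<integral>\<omega>. 0 \<partial>M)"
      using mean[OF b] u(1) um by (intro integral_cong_AE) (auto intro: measurable_from_subalg[OF assms(2)])
    finally show "(\<integral>\<omega>. (u \<omega> \<bullet> b) * (e \<omega> \<bullet> b) \<partial>M) = 0" by simp
  qed
  have expand: "(norm (u \<omega> + r *\<^sub>R e \<omega>))\<^sup>2
      = (norm (u \<omega>))\<^sup>2 + 2 * r * (\<Sum>b\<in>Basis. (u \<omega> \<bullet> b) * (e \<omega> \<bullet> b)) + r\<^sup>2 * (norm (e \<omega>))\<^sup>2" for \<omega>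
    unfolding power2_norm_eq_inner euclidean_inner[of "u \<omega>" "e \<omega>", symmetric]
    by (simp add: inner_simps inner_commute power2_eq_square)
  show "integrable M (\<lambda>\<omega>. (norm (u \<omega> + r *\<^sub>R (g (X \<omega>) - G (X \<omega>) \<omega>)))\<^sup>2)"
    unfolding e_def[symmetric] expand
    by (intro Bochner_Integration.integrable_add integrable_mult_right
        Bochner_Integration.integrable_sum u(2) e2 prod)
  have "(\<integral>\<omega>. (norm (u \<omega> + r *\<^sub>R e \<omega>))\<^sup>2 \<partial>M)
      = (\<integral>\<omega>. (norm (u \<omega>))\<^sup>2 \<partial>M) + r\<^sup>2 * (\<integral>\<omega>. (norm (e \<omega>))\<^sup>2 \<partial>M)"
    unfolding expand by (simp add: u(2) e2 prod zero)
  moreover have "(\<integral>\<omega>. (norm (e \<omega>))\<^sup>2 \<partial>M) \<le> \<sigma>\<^sup>2"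
  proof -
    have "(\<integral>\<omega>. (norm (e \<omega>))\<^sup>2 \<partial>M) = (\<integral>\<omega>. real_cond_exp M H (\<lambda>\<omega>. (norm (e \<omega>))\<^sup>2) \<omega> \<partial>M)"
      using real_cond_exp_int(2)[OF e2] by simp
    also have "\<dots> \<le> (\<integral>\<omega>. \<sigma>\<^sup>2 \<partial>M)"
      using var by (intro integral_mono_AE real_cond_exp_int(1) e2) auto
    finally show ?thesis by (simp add: prob_space)
  qed
  ultimately show "(\<integral>\<omega>. (norm (u \<omega> + r *\<^sub>R (g (X \<omega>) - G (X \<omega>) \<omega>)))\<^sup>2 \<partial>M)
      \<le> (\<integral>\<omega>. (norm (u \<omega>))\<^sup>2 \<partial>M) + r\<^sup>2 * \<sigma>\<^sup>2"
    unfolding e_def[symmetric] by (simp add: mult_left_mono)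
qed

text \<open>The variance of the norm is nonnegative.\<close>

lemma (in prob_space) expectation_norm_le_sqrt:
  fixes X :: "'a \<Rightarrow> 'b::{second_countable_topology, real_normed_vector}"
  assumes "X \<in> borel_measurable M" "integrable M (\<lambda>\<omega>. (norm (X \<omega>))\<^sup>2)"
  shows "integrable M (\<lambda>\<omega>. norm (X \<omega>))"
    and "expectation (\<lambda>\<omega>. norm (X \<omega>)) \<le> sqrt (expectation (\<lambda>\<omega>. (norm (X \<omega>))\<^sup>2))"
proof -
  have m: "(\<lambda>\<omega>. norm (X \<omega>)) \<in> borel_measurable M" using assms(1) by measurable
  show int: "integrable M (\<lambda>\<omega>. norm (X \<omega>))"
    by (rule square_integrable_imp_integrable[OF m assms(2)])
  have "0 \<le> variance (\<lambda>\<omega>. norm (X \<omega>))" by (rule variance_positive)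
  also have "\<dots> = expectation (\<lambda>\<omega>. (norm (X \<omega>))\<^sup>2) - (expectation (\<lambda>\<omega>. norm (X \<omega>)))\<^sup>2" 
    by (rule variance_eq[OF int assms(2)])
  finally have "(expectation (\<lambda>\<omega>. norm (X \<omega>)))\<^sup>2 \<le> expectation (\<lambda>\<omega>. (norm (X \<omega>))\<^sup>2)"
    by simp
  thus "expectation (\<lambda>\<omega>. norm (X \<omega>)) \<le> sqrt (expectation (\<lambda>\<omega>. (norm (X \<omega>))\<^sup>2))"
    by (rule real_le_rsqrt)
qed

section \<open>The random run\<close>

text \<open>Compactness bounds the linear form on \<open>C\<close>, so that its \<open>INF\<close>
  and \<open>SUP\<close> are genuine bounds for the comparator \<open>y\<close>.\<close>

lemma regret_at_least:
  assumes "compact C" "y \<in> C"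
  shows "(\<Sum>t=1..T. d t \<bullet> (v t - y)) \<le> regret Convex_Min T C d v"
    and "(\<Sum>t=1..T. d t \<bullet> (y - v t)) \<le> regret Submodular_Max T C d v"
proof -
  have "compact ((\<lambda>x. \<Sum>t=1..T. d t \<bullet> x) ` C)"
    using assms(1) by (intro compact_continuous_image continuous_intros)
  hence b: "bounded ((\<lambda>x. \<Sum>t=1..T. d t \<bullet> x) ` C)" by (rule compact_imp_bounded)
  have "(INF x\<in>C. \<Sum>t=1..T. d t \<bullet> x) \<le> (\<Sum>t=1..T. d t \<bullet> y)"
    using assms(2) bounded_imp_bdd_below[OF b] by (intro cINF_lower) auto
  thus "(\<Sum>t=1..T. d t \<bullet> (v t - y)) \<le> regret Convex_Min T C d v"
    by (simp add: inner_diff_right sum_subtractf)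
  have "(\<Sum>t=1..T. d t \<bullet> y) \<le> (SUP x\<in>C. \<Sum>t=1..T. d t \<bullet> x)"
    using assms(2) bounded_imp_bdd_above[OF b] by (intro cSUP_upper) auto
  thus "(\<Sum>t=1..T. d t \<bullet> (y - v t)) \<le> regret Submodular_Max T C d v"
    by (simp add: inner_diff_right sum_subtractf)
qed

text \<open>What both versions share. Convexity and the box stay outside: they enter through
  \<open>iterate_in_domain\<close>, which holds for different reasons in the two versions, and
  through the drift and one-step bounds that later lemmas take as premises.\<close>

locale meta_frank_wolfe_run = prob_space M for M :: "'w measure" +
  fixes H :: "nat \<Rightarrow> nat \<Rightarrow> 'w measure"
    and T K :: nat
    and C S V :: "'a::euclidean_space set"
    and gf :: "nat \<Rightarrow> 'a \<Rightarrow> 'a"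
    and G :: "nat \<Rightarrow> nat \<Rightarrow> 'a \<Rightarrow> 'w \<Rightarrow> 'a"
    and A :: "nat \<Rightarrow> 'a list \<Rightarrow> 'a"
    and x v d :: "nat \<Rightarrow> nat \<Rightarrow> 'w \<Rightarrow> 'a"
    and z :: 'a
    and \<rho> \<eta> :: "nat \<Rightarrow> real"
    and ver :: mfw_version
    and L \<sigma> Reg :: real
  assumes K_pos: "1 \<le> K"
    and compact_C: "compact C"
    and gradient_lipschitz: "\<And>t. t \<in> {1..T} \<Longrightarrow> L-lipschitz_on S (gf t)"
    and past_subalgebra: "\<And>t k. t \<in> {1..T} \<Longrightarrow> k \<in> {1..K} \<Longrightarrow> subalgebra M (H t k)"
    and past_answers: "\<And>t k s j. t \<in> {1..T} \<Longrightarrow> k \<in> {1..K} \<Longrightarrow> s \<in> {1..T} \<Longrightarrow> j \<in> {1..K} \<Longrightarrow>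
            s < t \<or> (s = t \<and> j < k) \<Longrightarrow>
            (\<lambda>\<omega>. G s j (x s j \<omega>) \<omega>) \<in> borel_measurable (H t k)"
    and gradient_oracle: "\<And>t k. t \<in> {1..T} \<Longrightarrow> k \<in> {1..K} \<Longrightarrow>
            stochastic_gradient_query M (H t k) S (gf t) \<sigma> (G t k)"
    and linear_oracles: "\<And>k. k \<in> {1..K} \<Longrightarrow> linear_optimization_oracle ver T C V Reg (A k)"
    and zero_feedback: "0 \<in> V"
    and feedback: "AE \<omega> in M. \<forall>t\<in>{1..T}. \<forall>k\<in>{1..K}. d t k \<omega> \<in> V"
    and \<rho>: "\<And>k. k \<in> {1..K} \<Longrightarrow> \<rho> k = 2 / (real k + 3) powr (2/3)"
    and run: "\<And>\<omega>. \<omega> \<in> space M \<Longrightarrow>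
            meta_frank_wolfe ver T K \<rho> \<eta> z A (\<lambda>t k y. G t k y \<omega>)
              (\<lambda>t k. x t k \<omega>) (\<lambda>t k. v t k \<omega>) (\<lambda>t k. d t k \<omega>)"
    and iterate_in_domain: "\<And>t k \<omega>. t \<in> {1..T} \<Longrightarrow> k \<in> {1..K} \<Longrightarrow> \<omega> \<in> space M \<Longrightarrow> x t k \<omega> \<in> S"
begin

lemma run_eqs:
  assumes "\<omega> \<in> space M" "t \<in> {1..T}"
  shows "d t 0 \<omega> = 0" "x t 1 \<omega> = z" "x t (Suc 0) \<omega> = z"
    and "k \<in> {1..K} \<Longrightarrow> v t k \<omega> = A k (map (\<lambda>s. d s k \<omega>) [1..<t])"
    and "k \<in> {1..K} \<Longrightarrow> x t (Suc k) \<omega> = fw_step ver (\<eta> k) (x t k \<omega>) (v t k \<omega>)"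
    and "k \<in> {1..K} \<Longrightarrow> d t k \<omega> = (1 - \<rho> k) *\<^sub>R d t (k - 1) \<omega> + \<rho> k *\<^sub>R G t k (x t k \<omega>) \<omega>"
  using run[OF assms(1)] assms(2) by (auto simp: meta_frank_wolfe_def)

lemma output_in_C:
  assumes "\<omega> \<in> space M" "t \<in> {1..T}" "k \<in> {1..K}"
  shows "v t k \<omega> \<in> C"
  using run_eqs(4)[OF assms] linear_oracles[OF assms(3)] by (auto simp: linear_optimization_oracle_def)

text \<open>Feeding only zero vectors produces regret 0; this is the purpose of
  \<open>0 \<in> V\<close>. Nonnegativity is needed where \<open>Reg\<close> is enlarged or its
  decay is discarded.\<close>

lemma regret_nonneg:
  assumes "C \<noteq> {}"
  shows "0 \<le> Reg"
proof -
  obtain y where y: "y \<in> C" using assms by blast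
  have "regret ver T C (\<lambda>t. 0) (\<lambda>t. A 1 (map (\<lambda>s. 0) [1..<t])) \<le> Reg"
    using linear_oracles[of 1] K_pos zero_feedback by (auto simp: linear_optimization_oracle_def)
  thus ?thesis
    using regret_at_least[OF compact_C y, where T = T and d = "\<lambda>t. 0"]
    by (cases ver) (force intro: order_trans)+
qed

text \<open>The guarantee covers every sequence in \<open>V\<close>, so it applies to the realised
  feedback of each sample point outside the null set where that feedback leaves
  \<open>V\<close>.\<close>

lemma regret_bound:
  shows "AE \<omega> in M. \<forall>k\<in>{1..K}. regret ver T C (\<lambda>t. d t k \<omega>) (\<lambda>t. v t k \<omega>) \<le> Reg"
  using feedback AE_space
proof eventually_elim
  case (elim \<omega>)
  show ?case
  proof
    fix k assume k: "k \<in> {1..K}"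
    have "regret ver T C (\<lambda>t. d t k \<omega>) (\<lambda>t. A k (map (\<lambda>s. d s k \<omega>) [1..<t])) \<le> Reg"
      using linear_oracles[OF k] elim k by (auto simp: linear_optimization_oracle_def)
    moreover have "regret ver T C (\<lambda>t. d t k \<omega>) (\<lambda>t. v t k \<omega>)
        = regret ver T C (\<lambda>t. d t k \<omega>) (\<lambda>t. A k (map (\<lambda>s. d s k \<omega>) [1..<t]))"
      using run_eqs(4)[OF elim(2) _ k] by (cases ver) auto
    ultimately show "regret ver T C (\<lambda>t. d t k \<omega>) (\<lambda>t. v t k \<omega>) \<le> Reg" by simp
  qed
qed

section \<open>Measurability with respect to the past\<close>

lemma space_H: "t \<in> {1..T} \<Longrightarrow> k \<in> {1..K} \<Longrightarrow> space (H t k) = space M"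
  using past_subalgebra by (auto simp: subalgebra_def)

text \<open>Only the gradient answers are assumed to be part of the past; measurability of all that
  the algorithm computes from them is derived, starting here.\<close>

lemma feedback_measurable:
  assumes tk: "t \<in> {1..T}" "k \<in> {1..K}" and s: "s \<in> {1..T}"
    and "j \<le> K" "s < t \<or> s = t \<and> j < k"
  shows "d s j \<in> borel_measurable (H t k)"
  using assms(4,5)
proof (induction j)
  case 0
  have "(\<lambda>\<omega>. 0) \<in> borel_measurable (H t k)" by simp
  thus ?case using run_eqs(1)[OF _ s] space_H[OF tk] by (subst measurable_cong) auto
next
  case (Suc j)
  have [measurable]: "d s j \<in> borel_measurable (H t k)" using Suc by auto
  have [measurable]: "(\<lambda>\<omega>. G s (Suc j) (x s (Suc j) \<omega>) \<omega>) \<in> borel_measurable (H t k)"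
    using Suc.prems by (intro past_answers tk s) auto
  have "(\<lambda>\<omega>. (1 - \<rho> (Suc j)) *\<^sub>R d s j \<omega> + \<rho> (Suc j) *\<^sub>R G s (Suc j) (x s (Suc j) \<omega>) \<omega>)
      \<in> borel_measurable (H t k)" by measurable
  thus ?case
    by (rule measurable_cong[THEN iffD1, rotated])
      (use run_eqs(6)[OF _ s, of _ "Suc j"] space_H[OF tk] Suc.prems in auto)
qed

text \<open>The index \<open>j\<close> is not tied to \<open>k\<close>: outputs of round
  \<open>t\<close> depend on feedback of rounds \<open>s < t\<close> alone. Hence all iterates of
  the round, including the point played, are known before any of its queries.\<close>

lemma output_measurable:
  assumes tk: "t \<in> {1..T}" "k \<in> {1..K}" and j: "j \<in> {1..K}"
  shows "v t j \<in> borel_measurable (H t k)"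
proof -
  have "(\<lambda>\<omega>. \<lambda>s\<in>{1..<t}. d s j \<omega>) \<in> measurable (H t k) (Pi\<^sub>M {1..<t} (\<lambda>_. borel))"
    using tk j by (intro measurable_restrict feedback_measurable) auto
  moreover have "(\<lambda>d. A j (map d [1..<t])) \<in> borel_measurable (Pi\<^sub>M {1..<t} (\<lambda>_. borel))"
    using linear_oracles[OF j] tk by (auto simp: linear_optimization_oracle_def)
  ultimately have "(\<lambda>\<omega>. A j (map (\<lambda>s\<in>{1..<t}. d s j \<omega>) [1..<t])) \<in> borel_measurable (H t k)"
    by (rule measurable_compose)
  thus ?thesis
  proof (rule measurable_cong[THEN iffD1, rotated])
    fix \<omega> assume "\<omega> \<in> space (H t k)"
    hence \<omega>: "\<omega> \<in> space M" using space_H[OF tk] by simp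
    have eq: "map (\<lambda>s\<in>{1..<t}. d s j \<omega>) [1..<t] = map (\<lambda>s. d s j \<omega>) [1..<t]" by auto
    show "A j (map (\<lambda>s\<in>{1..<t}. d s j \<omega>) [1..<t]) = v t j \<omega>"
      unfolding eq by (rule run_eqs(4)[OF \<omega> tk(1) j, symmetric])
  qed
qed

lemma iterate_measurable:
  assumes tk: "t \<in> {1..T}" "k \<in> {1..K}" and "1 \<le> j" "j \<le> Suc K"
  shows "x t j \<in> borel_measurable (H t k)"
  using assms(3,4)
proof (induction j rule: nat_induct_at_least)
  case base
  have "(\<lambda>\<omega>. z) \<in> borel_measurable (H t k)" by simp
  thus ?case using run_eqs(2)[OF _ tk(1)] space_H[OF tk] by (subst measurable_cong) auto
next
  case (Suc j)
  have [measurable]: "x t j \<in> borel_measurable (H t k)" using Suc by auto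
  have [measurable]: "v t j \<in> borel_measurable (H t k)"
    using Suc by (intro output_measurable tk) auto
  have "(\<lambda>\<omega>. fw_step ver (\<eta> j) (x t j \<omega>) (v t j \<omega>)) \<in> borel_measurable (H t k)"
    by (cases ver) simp_all
  thus ?case
    by (rule measurable_cong[THEN iffD1, rotated])
      (use run_eqs(5)[OF _ tk(1), of _ j] space_H[OF tk] Suc in auto)
qed

text \<open>Continuity of \<open>gf t\<close> is available on \<open>S\<close> only, so the
  composition factors through the restricted Borel space.\<close>

lemma gradient_measurable:
  assumes tk: "t \<in> {1..T}" "k \<in> {1..K}" and j: "j \<in> {1..K}"
  shows "(\<lambda>\<omega>. gf t (x t j \<omega>)) \<in> borel_measurable (H t k)"
proof -
  have "x t j \<in> measurable (H t k) (restrict_space borel S)"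
    using iterate_in_domain[OF tk(1) j] space_H[OF tk] iterate_measurable[OF tk] j
    by (intro measurable_restrict_space2) auto
  moreover have "gf t \<in> borel_measurable (restrict_space borel S)"
    using lipschitz_on_continuous_on[OF gradient_lipschitz[OF tk(1)]]
    by (rule borel_measurable_continuous_on_restrict)
  ultimately show ?thesis by (rule measurable_compose)
qed

text \<open>The index \<open>max 1 k\<close> makes \<open>k = 0\<close> a valid start of the recursion: there the estimate is \<open>0\<close>
  and the gradient is taken at the initial point.\<close>

definition estimation_error :: "nat \<Rightarrow> nat \<Rightarrow> 'w \<Rightarrow> 'a" where
  "estimation_error t k \<omega> = gf t (x t (max 1 k) \<omega>) - d t k \<omega>"

text \<open>The old error is known before query \<open>k\<close>; the new one contains its answer
  and is only measurable in \<open>M\<close>.\<close>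

lemma estimation_error_measurable:
  assumes "t \<in> {1..T}" "k \<in> {1..K}"
  shows "estimation_error t (k - 1) \<in> borel_measurable (H t k)"
    and "estimation_error t k \<in> borel_measurable M"
proof -
  have k: "max 1 (k - 1) \<in> {1..K}" using assms K_pos by auto
  have 1: "(\<lambda>\<omega>. gf t (x t (max 1 (k - 1)) \<omega>)) \<in> borel_measurable (H t k)"
    using assms(1,2) k by (rule gradient_measurable)
  have 2: "d t (k - 1) \<in> borel_measurable (H t k)"
    using assms by (intro feedback_measurable) auto
  from borel_measurable_diff[OF 1 2] show 3: "estimation_error t (k - 1) \<in> borel_measurable (H t k)"
    unfolding estimation_error_def .
  note sub = measurable_from_subalg[OF past_subalgebra[OF assms]]
  have X: "x t k \<in> borel_measurable (H t k)" using assms by (intro iterate_measurable) auto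
  have [measurable]: "(\<lambda>\<omega>. G t k (x t k \<omega>) \<omega>) \<in> borel_measurable M"
    using gradient_oracle[OF assms] X iterate_in_domain[OF assms]
    by (auto simp: stochastic_gradient_query_def)
  have [measurable]: "d t (k - 1) \<in> borel_measurable M" using 2 by (rule sub)
  have [measurable]: "(\<lambda>\<omega>. gf t (x t k \<omega>)) \<in> borel_measurable M"
    using gradient_measurable[OF assms assms(2)] by (rule sub)
  have "(\<lambda>\<omega>. gf t (x t k \<omega>) - ((1 - \<rho> k) *\<^sub>R d t (k - 1) \<omega> + \<rho> k *\<^sub>R G t k (x t k \<omega>) \<omega>))
      \<in> borel_measurable M" by measurable
  thus "estimation_error t k \<in> borel_measurable M"
    by (rule measurable_cong[THEN iffD1, rotated])
      (use run_eqs(6)[OF _ assms] assms in \<open>auto simp: estimation_error_def max_def\<close>)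
qed

text \<open>The new error is \<open>(1 - \<rho> k)\<close> times the sum of the old error and the
  gradient change \<open>q\<close>, plus \<open>\<rho> k\<close> times the noise. The first part is
  known before the query, and \<open>momentum_recursion\<close> applies with
  \<open>m = k + 3\<close>; its \<open>m + 1\<close> is the shift \<open>k + 4\<close> in the
  bound.\<close>

lemma estimation_error_square:
  assumes t: "t \<in> {1..T}" and "k \<le> K"
    and Q: "4 powr (2/3) * (norm (gf t z))\<^sup>2 \<le> Q" "4 * \<sigma>\<^sup>2 + B \<le> Q"
    and drift: "\<And>k \<omega>. k \<in> {1..K} \<Longrightarrow> \<omega> \<in> space M \<Longrightarrow>
      (norm (gf t (x t k \<omega>) - gf t (x t (max 1 (k - 1)) \<omega>)))\<^sup>2 \<le> \<delta> k"
    and \<delta>: "\<And>k. k \<in> {1..K} \<Longrightarrow> ((real k + 3)\<^sup>2 - (real k + 3)) * \<delta> k \<le> B"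
  shows "integrable M (\<lambda>\<omega>. (norm (estimation_error t k \<omega>))\<^sup>2) \<and>
    expectation (\<lambda>\<omega>. (norm (estimation_error t k \<omega>))\<^sup>2) \<le> Q / (real k + 4) powr (2/3)"
  using assms(2)
proof (induction k)
  case 0
  have eq: "norm (estimation_error t 0 \<omega>) = norm (gf t z)" if "\<omega> \<in> space M" for \<omega>
    using run_eqs(1-3)[OF that t] by (simp add: estimation_error_def)
  have "integrable M (\<lambda>\<omega>. (norm (gf t z))\<^sup>2)" by simp
  hence "integrable M (\<lambda>\<omega>. (norm (estimation_error t 0 \<omega>))\<^sup>2)"
    by (rule Bochner_Integration.integrable_cong[THEN iffD1, rotated 2]) (simp_all add: eq)
  moreover have "expectation (\<lambda>\<omega>. (norm (estimation_error t 0 \<omega>))\<^sup>2) = expectation (\<lambda>\<omega>. (norm (gf t z))\<^sup>2)"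
    by (rule Bochner_Integration.integral_cong) (simp_all add: eq)
  \<comment> \<open>With the estimate still 0, the error is the full initial gradient; the bound at
    \<open>k = 0\<close> is the origin of \<open>4 powr (2/3)\<close> in \<open>Q\<close>.\<close>
  moreover have "(norm (gf t z))\<^sup>2 \<le> Q / (0 + 4) powr (2/3)"
    using Q(1) by (simp add: le_divide_eq mult.commute)
  ultimately show ?case by (simp add: prob_space)
next
  case (Suc n)
  define k where "k = Suc n"
  have k: "k \<in> {1..K}" and kn: "k - 1 = n" using Suc.prems by (auto simp: k_def)
  have int: "integrable M (\<lambda>\<omega>. (norm (estimation_error t n \<omega>))\<^sup>2)"
    and IH: "expectation (\<lambda>\<omega>. (norm (estimation_error t n \<omega>))\<^sup>2) \<le> Q / (real k + 3) powr (2/3)"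
    using Suc by (auto simp: k_def add.commute)
  define a where "a \<omega> = gf t (x t k \<omega>)" for \<omega>
  define q where "q \<omega> = a \<omega> - gf t (x t (max 1 n) \<omega>)" for \<omega>
  define u where "u \<omega> = (1 - \<rho> k) *\<^sub>R (estimation_error t n \<omega> + q \<omega>)" for \<omega>
  have q: "(norm (q \<omega>))\<^sup>2 \<le> \<delta> k" if "\<omega> \<in> space M" for \<omega>
    using drift[OF k that] unfolding q_def a_def kn .
  \<comment> \<open>\<open>\<delta> k\<close> dominates a square at some sample point, and a
    probability space has one.\<close>
  have \<delta>0: "0 \<le> \<delta> k" 
    using not_empty q by (meson order_trans zero_le_power2 ex_in_conv)
  have Q0: "0 \<le> Q" using Q(1) by (rule order_trans[rotated]) simp
  have "4 \<le> real k + 3" using k by simp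
  note rec = momentum_recursion[OF this \<rho>[OF k] IH \<delta>[OF k] Q(2) \<delta>0 Q0]
  have r: "0 < \<rho> k" "\<rho> k \<le> 1" using rec(2,3) by auto
  have am: "a \<in> borel_measurable (H t k)"
    unfolding a_def by (rule gradient_measurable[OF t k k])
  have "(\<lambda>\<omega>. gf t (x t (max 1 n) \<omega>)) \<in> borel_measurable (H t k)"
    using k kn by (intro gradient_measurable t) auto
  with am have qm: "q \<in> borel_measurable (H t k)" unfolding q_def by measurable
  have em: "estimation_error t n \<in> borel_measurable (H t k)"
    using estimation_error_measurable(1)[OF t k] kn by simp
  have um: "u \<in> borel_measurable (H t k)" unfolding u_def using qm em by measurable
  note sub = measurable_from_subalg[OF past_subalgebra[OF t k]]
  have u2: "(norm (u \<omega>))\<^sup>2 \<le> (1 - \<rho> k) * (norm (estimation_error t n \<omega>))\<^sup>2 + (2 / \<rho> k - 1) * \<delta> k"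
    if "\<omega> \<in> space M" for \<omega>
  proof -
    have "(2 / \<rho> k - 1) * (norm (q \<omega>))\<^sup>2 \<le> (2 / \<rho> k - 1) * \<delta> k"
      using r q[OF that] by (intro mult_left_mono) (auto simp: field_simps)
    thus ?thesis
      using norm_momentum_error_le[OF r, of "estimation_error t n \<omega>" "q \<omega>"] by (simp add: u_def)
  qed
  have bint: "integrable M (\<lambda>\<omega>. (1 - \<rho> k) * (norm (estimation_error t n \<omega>))\<^sup>2 + (2 / \<rho> k - 1) * \<delta> k)"
    using int by simp
  have ui: "integrable M (\<lambda>\<omega>. (norm (u \<omega>))\<^sup>2)"
  proof (rule Bochner_Integration.integrable_bound[OF bint])
    show "(\<lambda>\<omega>. (norm (u \<omega>))\<^sup>2) \<in> borel_measurable M" using sub[OF um] by measurable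
    show "AE \<omega> in M. norm ((norm (u \<omega>))\<^sup>2) \<le>
        norm ((1 - \<rho> k) * (norm (estimation_error t n \<omega>))\<^sup>2 + (2 / \<rho> k - 1) * \<delta> k)"
      using u2 by (intro AE_I2) (force intro: order_trans[OF _ abs_ge_self])
  qed
  have "expectation (\<lambda>\<omega>. (norm (u \<omega>))\<^sup>2)
      \<le> expectation (\<lambda>\<omega>. (1 - \<rho> k) * (norm (estimation_error t n \<omega>))\<^sup>2 + (2 / \<rho> k - 1) * \<delta> k)"
    using ui bint u2 by (rule integral_mono)
  also have "\<dots> = (1 - \<rho> k) * expectation (\<lambda>\<omega>. (norm (estimation_error t n \<omega>))\<^sup>2) + (2 / \<rho> k - 1) * \<delta> k"
    using int by (simp add: prob_space)
  finally have ub: "expectation (\<lambda>\<omega>. (norm (u \<omega>))\<^sup>2)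
    \<le> (1 - \<rho> k) * expectation (\<lambda>\<omega>. (norm (estimation_error t n \<omega>))\<^sup>2) + (2 / \<rho> k - 1) * \<delta> k" .
  have xm: "x t k \<in> borel_measurable (H t k)" using k by (intro iterate_measurable t) auto
  have eq: "norm (u \<omega> + \<rho> k *\<^sub>R (gf t (x t k \<omega>) - G t k (x t k \<omega>) \<omega>)) = norm (estimation_error t k \<omega>)"
    if "\<omega> \<in> space M" for \<omega>
  proof -
    have "estimation_error t k \<omega> = a \<omega> - ((1 - \<rho> k) *\<^sub>R d t n \<omega> + \<rho> k *\<^sub>R G t k (x t k \<omega>) \<omega>)"
      using run_eqs(6)[OF that t k] k kn by (simp add: estimation_error_def a_def max_def)
    also have "\<dots> = u \<omega> + \<rho> k *\<^sub>R (gf t (x t k \<omega>) - G t k (x t k \<omega>) \<omega>)"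
      by (simp add: u_def q_def estimation_error_def a_def algebra_simps)
    finally show ?thesis by simp
  qed
  note sq = stochastic_gradient_query_square[OF prob_space_axioms past_subalgebra[OF t k]
      gradient_oracle[OF t k] xm iterate_in_domain[OF t k] sub[OF gradient_measurable[OF t k k]] um ui,
      of "\<rho> k"]
  have "integrable M (\<lambda>\<omega>. (norm (estimation_error t k \<omega>))\<^sup>2)"
    using sq(1) by (rule Bochner_Integration.integrable_cong[THEN iffD1, rotated 2]) (simp_all add: eq)
  moreover have "expectation (\<lambda>\<omega>. (norm (estimation_error t k \<omega>))\<^sup>2)
      = expectation (\<lambda>\<omega>. (norm (u \<omega> + \<rho> k *\<^sub>R (gf t (x t k \<omega>) - G t k (x t k \<omega>) \<omega>)))\<^sup>2)"
    by (rule Bochner_Integration.integral_cong) (simp_all add: eq)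
  moreover have "\<dots> \<le> Q / (real k + 4) powr (2/3)"
  proof -
    have "real k + 3 + 1 = real k + 4" by simp
    from sq(2) ub rec(1)[unfolded this] show ?thesis by linarith
  qed
  ultimately show ?case by (simp add: k_def)
qed

text \<open>The \<open>- 1/2\<close> is carried along for the submodular version, where it pays for
  the discretisation error.\<close>

lemma total_estimation_error:
  assumes Q: "\<And>t. t \<in> {1..T} \<Longrightarrow> 4 powr (2/3) * (norm (gf t z))\<^sup>2 \<le> Q" "4 * \<sigma>\<^sup>2 + B \<le> Q" "0 \<le> Q"
    and drift: "\<And>t k \<omega>. t \<in> {1..T} \<Longrightarrow> k \<in> {1..K} \<Longrightarrow> \<omega> \<in> space M \<Longrightarrow>
      (norm (gf t (x t k \<omega>) - gf t (x t (max 1 (k - 1)) \<omega>)))\<^sup>2 \<le> \<delta> k"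
    and \<delta>: "\<And>k. k \<in> {1..K} \<Longrightarrow> ((real k + 3)\<^sup>2 - (real k + 3)) * \<delta> k \<le> B"
  shows "integrable M (\<lambda>\<omega>. \<Sum>k=1..K. \<Sum>t=1..T. norm (estimation_error t k \<omega>))"
    and "expectation (\<lambda>\<omega>. \<Sum>k=1..K. \<Sum>t=1..T. norm (estimation_error t k \<omega>))
      \<le> real T * (sqrt Q * (3/2 * real K powr (2/3) - 1/2))"
proof -
  have int: "integrable M (\<lambda>\<omega>. norm (estimation_error t k \<omega>))"
    and bd: "expectation (\<lambda>\<omega>. norm (estimation_error t k \<omega>)) \<le> sqrt Q * (1 / (real k + 4) powr (1/3))"
    if tk: "t \<in> {1..T}" "k \<in> {1..K}" for t k
  proof -
    have sq: "integrable M (\<lambda>\<omega>. (norm (estimation_error t k \<omega>))\<^sup>2)"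
      "expectation (\<lambda>\<omega>. (norm (estimation_error t k \<omega>))\<^sup>2) \<le> Q / (real k + 4) powr (2/3)"
      using estimation_error_square[OF tk(1) _ Q(1)[OF tk(1)] Q(2) drift[OF tk(1)] \<delta>, of k] tk by auto
    note en = expectation_norm_le_sqrt[OF estimation_error_measurable(2)[OF tk] sq(1)]
    show "integrable M (\<lambda>\<omega>. norm (estimation_error t k \<omega>))" by (rule en)
    note en(2)
    also have "sqrt (expectation (\<lambda>\<omega>. (norm (estimation_error t k \<omega>))\<^sup>2)) \<le> sqrt (Q / (real k + 4) powr (2/3))"
      using sq(2) by simp
    also have "\<dots> = sqrt Q * (1 / (real k + 4) powr (1/3))"
      by (simp add: powr_thirds(2) real_sqrt_divide)
    finally show "expectation (\<lambda>\<omega>. norm (estimation_error t k \<omega>)) \<le> sqrt Q * (1 / (real k + 4) powr (1/3))" .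
  qed
  show "integrable M (\<lambda>\<omega>. \<Sum>k=1..K. \<Sum>t=1..T. norm (estimation_error t k \<omega>))"
    using int by (intro Bochner_Integration.integrable_sum) auto
  have "expectation (\<lambda>\<omega>. \<Sum>k=1..K. \<Sum>t=1..T. norm (estimation_error t k \<omega>))
      = (\<Sum>k=1..K. \<Sum>t=1..T. expectation (\<lambda>\<omega>. norm (estimation_error t k \<omega>)))"
    using int by (subst Bochner_Integration.integral_sum)
      (auto intro!: Bochner_Integration.integrable_sum sum.cong Bochner_Integration.integral_sum)
  also have "\<dots> \<le> (\<Sum>k=1..K. \<Sum>t=1..T. sqrt Q * (1 / (real k + 4) powr (1/3)))"
    using bd by (intro sum_mono) auto
  also have "\<dots> = real T * (sqrt Q * (\<Sum>k=1..K. 1 / (real k + 4) powr (1/3)))"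
    by (simp add: sum_distrib_left)
  also have "\<dots> \<le> real T * (sqrt Q * (3/2 * real K powr (2/3) - 1/2))"
    using sum_inverse_cube_root_le[OF K_pos] Q(3) by (intro mult_left_mono) auto
  finally show "expectation (\<lambda>\<omega>. \<Sum>k=1..K. \<Sum>t=1..T. norm (estimation_error t k \<omega>))
      \<le> real T * (sqrt Q * (3/2 * real K powr (2/3) - 1/2))" .
qed

text \<open>Cauchy-Schwarz is applied pathwise to the estimation error and the displacement from
  \<open>y\<close>, whatever their dependence. The quantifier over \<open>k\<close> inside
  \<open>AE\<close> gives one null set for all inner steps.\<close>

lemma linear_gap:
  assumes y: "y \<in> C"
  shows "ver = Convex_Min \<Longrightarrow> AE \<omega> in M. \<forall>k\<in>{1..K}. (\<Sum>t=1..T. gf t (x t k \<omega>) \<bullet> (v t k \<omega> - y))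
      \<le> Reg + diameter C * (\<Sum>t=1..T. norm (estimation_error t k \<omega>))"
    and "ver = Submodular_Max \<Longrightarrow> AE \<omega> in M. \<forall>k\<in>{1..K}. (\<Sum>t=1..T. gf t (x t k \<omega>) \<bullet> (y - v t k \<omega>))
      \<le> Reg + diameter C * (\<Sum>t=1..T. norm (estimation_error t k \<omega>))"
proof -
  have err: "gf t (x t k \<omega>) \<bullet> w \<le> d t k \<omega> \<bullet> w + diameter C * norm (estimation_error t k \<omega>)"
    if "k \<in> {1..K}" "norm w \<le> diameter C" for t k \<omega> w
  proof -
    have "estimation_error t k \<omega> \<bullet> w \<le> norm (estimation_error t k \<omega>) * diameter C"
      by (rule order_trans[OF norm_cauchy_schwarz mult_left_mono[OF that(2) norm_ge_zero]])
    moreover have "estimation_error t k \<omega> = gf t (x t k \<omega>) - d t k \<omega>"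
      using that(1) by (simp add: estimation_error_def max_def)
    ultimately show ?thesis by (simp add: inner_diff_left mult.commute)
  qed
  have diam: "norm (v t k \<omega> - y) \<le> diameter C" "norm (y - v t k \<omega>) \<le> diameter C"
    if "\<omega> \<in> space M" "t \<in> {1..T}" "k \<in> {1..K}" for t k \<omega>
    using diameter_bounded_bound[OF compact_imp_bounded[OF compact_C] output_in_C[OF that] y]
    by (simp_all add: dist_norm norm_minus_commute)
  show "AE \<omega> in M. \<forall>k\<in>{1..K}. (\<Sum>t=1..T. gf t (x t k \<omega>) \<bullet> (v t k \<omega> - y))
      \<le> Reg + diameter C * (\<Sum>t=1..T. norm (estimation_error t k \<omega>))" if "ver = Convex_Min"
    using regret_bound AE_space
  proof eventually_elim
    case (elim \<omega>)
    show ?case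
    proof
      fix k assume k: "k \<in> {1..K}"
      have "(\<Sum>t=1..T. gf t (x t k \<omega>) \<bullet> (v t k \<omega> - y))
          \<le> (\<Sum>t=1..T. d t k \<omega> \<bullet> (v t k \<omega> - y) + diameter C * norm (estimation_error t k \<omega>))"
        using diam(1)[OF elim(2) _ k] by (intro sum_mono err k) auto
      also have "\<dots> = (\<Sum>t=1..T. d t k \<omega> \<bullet> (v t k \<omega> - y))
          + diameter C * (\<Sum>t=1..T. norm (estimation_error t k \<omega>))"
        by (simp add: sum.distrib sum_distrib_left)
      also have "(\<Sum>t=1..T. d t k \<omega> \<bullet> (v t k \<omega> - y)) \<le> Reg"
        using regret_at_least(1)[OF compact_C y, of "\<lambda>t. d t k \<omega>" "\<lambda>t. v t k \<omega>" T] elim(1) k that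
        by fastforce
      finally show "(\<Sum>t=1..T. gf t (x t k \<omega>) \<bullet> (v t k \<omega> - y))
          \<le> Reg + diameter C * (\<Sum>t=1..T. norm (estimation_error t k \<omega>))" by simp
    qed
  qed
  show "AE \<omega> in M. \<forall>k\<in>{1..K}. (\<Sum>t=1..T. gf t (x t k \<omega>) \<bullet> (y - v t k \<omega>))
      \<le> Reg + diameter C * (\<Sum>t=1..T. norm (estimation_error t k \<omega>))" if "ver = Submodular_Max"
    using regret_bound AE_space
  proof eventually_elim
    case (elim \<omega>)
    show ?case
    proof
      fix k assume k: "k \<in> {1..K}"
      have "(\<Sum>t=1..T. gf t (x t k \<omega>) \<bullet> (y - v t k \<omega>))
          \<le> (\<Sum>t=1..T. d t k \<omega> \<bullet> (y - v t k \<omega>) + diameter C * norm (estimation_error t k \<omega>))"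
        using diam(2)[OF elim(2) _ k] by (intro sum_mono err k) auto
      also have "\<dots> = (\<Sum>t=1..T. d t k \<omega> \<bullet> (y - v t k \<omega>))
          + diameter C * (\<Sum>t=1..T. norm (estimation_error t k \<omega>))"
        by (simp add: sum.distrib sum_distrib_left)
      also have "(\<Sum>t=1..T. d t k \<omega> \<bullet> (y - v t k \<omega>)) \<le> Reg"
        using regret_at_least(2)[OF compact_C y, of "\<lambda>t. d t k \<omega>" "\<lambda>t. v t k \<omega>" T] elim(1) k that
        by fastforce
      finally show "(\<Sum>t=1..T. gf t (x t k \<omega>) \<bullet> (y - v t k \<omega>))
          \<le> Reg + diameter C * (\<Sum>t=1..T. norm (estimation_error t k \<omega>))" by simp
    qed
  qed
qed

text \<open>Continuity on a compact set makes the values bounded. Only the last iterate is required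
  to lie in \<open>C\<close>, since in the submodular version the earlier ones may lie
  outside.\<close>

lemma final_value_integrable:
  assumes "\<And>t \<omega>. t \<in> {1..T} \<Longrightarrow> \<omega> \<in> space M \<Longrightarrow> x t (Suc K) \<omega> \<in> C"
    and "\<And>t. t \<in> {1..T} \<Longrightarrow> continuous_on C (f t)"
  shows "integrable M (\<lambda>\<omega>. \<Sum>t=1..T. f t (x t (Suc K) \<omega>) :: real)"
proof (rule Bochner_Integration.integrable_sum)
  fix t assume t: "t \<in> {1..T}"
  have "bounded (f t ` C)"
    using assms(2)[OF t] compact_C by (intro compact_imp_bounded compact_continuous_image)
  then obtain b where b: "\<And>y. y \<in> C \<Longrightarrow> norm (f t y) \<le> b" by (auto simp: bounded_iff)
  have K: "K \<in> {1..K}" using K_pos by simp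
  have "x t (Suc K) \<in> borel_measurable M"
    using iterate_measurable[OF t K, of "Suc K"] measurable_from_subalg[OF past_subalgebra[OF t K]] by simp
  hence "x t (Suc K) \<in> measurable M (restrict_space borel C)"
    using assms(1)[OF t] by (intro measurable_restrict_space2) auto
  hence "(\<lambda>\<omega>. f t (x t (Suc K) \<omega>)) \<in> borel_measurable M"
    by (rule measurable_compose) (rule borel_measurable_continuous_on_restrict[OF assms(2)[OF t]])
  thus "integrable M (\<lambda>\<omega>. f t (x t (Suc K) \<omega>))"
    using b assms(1)[OF t] by (intro integrable_const_bound[where B = b]) (auto intro!: AE_I2)
qed

end

section \<open>Accumulation over the inner steps\<close>

lemma sum_harmonic_shift_le_ln: "(\<Sum>k=1..K. 1 / (real k + 3)) \<le> ln (real K + 1)"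
proof (induction K)
  case (Suc n)
  have "ln ((real n + 1) / (real n + 2)) \<le> (real n + 1) / (real n + 2) - 1"
    by (intro ln_le_minus_one) auto
  also have "\<dots> = - (1 / (real n + 2))" by (simp add: field_simps)
  finally have "1 / (real n + 2) \<le> ln (real n + 2) - ln (real n + 1)" by (simp add: ln_div)
  moreover have "1 / (real (Suc n) + 3) \<le> 1 / (real n + 2)" by (intro divide_left_mono) auto
  moreover have "real (Suc n) + 1 = real n + 2" by simp
  moreover have "(\<Sum>k=1..Suc n. 1 / (real k + 3)) = (\<Sum>k=1..n. 1 / (real k + 3)) + 1 / (real (Suc n) + 3)"
    by simp
  ultimately show ?case using Suc by (simp only:)
qed simp

text \<open>Multiplying by \<open>k + 3\<close> telescopes, because
  \<open>(k + 3) * (1 - 1 / (k + 3)) = (k - 1) + 3\<close>; each \<open>e k\<close> then has weight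
  1.\<close>

lemma weighted_descent:
  fixes h e :: "nat \<Rightarrow> real"
  assumes "\<And>k. k \<in> {1..K} \<Longrightarrow> h (Suc k)
      \<le> (1 - 1 / (real k + 3)) * h k + 1 / (real k + 3) * e k + (1 / (real k + 3))\<^sup>2 * c"
  shows "(real K + 3) * h (Suc K) \<le> 3 * h 1 + (\<Sum>k=1..K. e k) + c * (\<Sum>k=1..K. 1 / (real k + 3))"
  using assms
proof (induction K)
  case (Suc n)
  define m where "m = real (Suc n) + 3"
  have m: "0 < m" "m - 1 = real n + 3" by (auto simp: m_def)
  have "h (Suc (Suc n)) \<le> (1 - 1 / m) * h (Suc n) + 1 / m * e (Suc n) + (1 / m)\<^sup>2 * c"
    using Suc.prems[of "Suc n"] by (simp add: m_def)
  hence "m * h (Suc (Suc n)) \<le> m * ((1 - 1 / m) * h (Suc n) + 1 / m * e (Suc n) + (1 / m)\<^sup>2 * c)"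
    using m(1) by (intro mult_left_mono) auto
  also have "\<dots> = (m - 1) * h (Suc n) + e (Suc n) + c * (1 / m)"
    using m(1) by (simp add: field_simps power2_eq_square)
  finally have "m * h (Suc (Suc n)) \<le> (real n + 3) * h (Suc n) + e (Suc n) + c * (1 / m)"
    by (simp only: m(2))
  thus ?case using Suc by (simp add: m_def algebra_simps)
qed simp

text \<open>Only \<open>h 1\<close> keeps its decay. For the errors the later contractions are
  dropped, which requires \<open>0 \<le> e k\<close>, and \<open>1 - exp (- \<eta>)\<close> is
  bounded by \<open>\<eta>\<close>.\<close>

lemma geometric_ascent:
  fixes h e :: "nat \<Rightarrow> real"
  assumes "\<And>k. k \<in> {1..n} \<Longrightarrow> h (Suc k) \<le> exp (- \<eta>) * h k + (1 - exp (- \<eta>)) * e k"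
    and "\<And>k. k \<in> {1..n} \<Longrightarrow> 0 \<le> e k" and "0 \<le> \<eta>"
  shows "h (Suc n) \<le> exp (- (real n * \<eta>)) * h 1 + \<eta> * (\<Sum>k=1..n. e k)"
  using assms(1,2)
proof (induction n)
  case (Suc n)
  have S: "0 \<le> \<eta> * (\<Sum>k=1..n. e k)" using Suc.prems assms(3) by (auto intro!: sum_nonneg mult_nonneg_nonneg)
  have q: "1 - exp (- \<eta>) \<le> \<eta>" using exp_ge_add_one_self[of "- \<eta>"] by linarith
  have "h (Suc (Suc n)) \<le> exp (- \<eta>) * h (Suc n) + (1 - exp (- \<eta>)) * e (Suc n)"
    using Suc.prems by simp
  also have "\<dots> \<le> exp (- \<eta>) * (exp (- (real n * \<eta>)) * h 1 + \<eta> * (\<Sum>k=1..n. e k)) + \<eta> * e (Suc n)"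
    using Suc q by (intro add_mono mult_left_mono mult_right_mono) auto
  also have "\<dots> \<le> exp (- \<eta>) * (exp (- (real n * \<eta>)) * h 1) + \<eta> * (\<Sum>k=1..n. e k) + \<eta> * e (Suc n)"
    using S assms(3) mult_right_mono[of "exp (- \<eta>)" 1 "\<eta> * (\<Sum>k=1..n. e k)"]
    by (simp add: distrib_left)
  also have "\<dots> = exp (- (real (Suc n) * \<eta>)) * h 1 + \<eta> * (\<Sum>k=1..Suc n. e k)"
    by (simp add: mult.assoc[symmetric] exp_add[symmetric] algebra_simps)
  finally show ?case .
qed simp

context meta_frank_wolfe_run
begin

lemma convex_version_bound:
  assumes ver: "ver = Convex_Min" and y: "y \<in> C"
    and step: "\<And>t k \<omega>. t \<in> {1..T} \<Longrightarrow> k \<in> {1..K} \<Longrightarrow> \<omega> \<in> space M \<Longrightarrow>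
      f t (x t (Suc k) \<omega>) - f t y \<le> (1 - 1 / (real k + 3)) * (f t (x t k \<omega>) - f t y)
        + 1 / (real k + 3) * (gf t (x t k \<omega>) \<bullet> (v t k \<omega> - y)) + (1 / (real k + 3))\<^sup>2 * c"
    and F: "integrable M (\<lambda>\<omega>. \<Sum>t=1..T. f t (x t (Suc K) \<omega>))"
    and W: "integrable M (\<lambda>\<omega>. \<Sum>k=1..K. \<Sum>t=1..T. norm (estimation_error t k \<omega>))"
  shows "(real K + 3) * (expectation (\<lambda>\<omega>. \<Sum>t=1..T. f t (x t (Suc K) \<omega>)) - (\<Sum>t=1..T. f t y))
    \<le> 3 * (\<Sum>t=1..T. f t z - f t y) + real K * Reg
      + diameter C * expectation (\<lambda>\<omega>. \<Sum>k=1..K. \<Sum>t=1..T. norm (estimation_error t k \<omega>))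
      + real T * c * (\<Sum>k=1..K. 1 / (real k + 3))"
proof -
  let ?W = "\<lambda>\<omega>. \<Sum>k=1..K. \<Sum>t=1..T. norm (estimation_error t k \<omega>)"
  let ?F = "\<lambda>\<omega>. \<Sum>t=1..T. f t (x t (Suc K) \<omega>)"
  let ?B = "3 * (\<Sum>t=1..T. f t z - f t y) + real K * Reg + real T * c * (\<Sum>k=1..K. 1 / (real k + 3))"
  have "AE \<omega> in M. (real K + 3) * (?F \<omega> - (\<Sum>t=1..T. f t y)) \<le> ?B + diameter C * ?W \<omega>"
    using linear_gap(1)[OF y ver] AE_space
  proof eventually_elim
    case (elim \<omega>)
    define h where "h k = (\<Sum>t=1..T. f t (x t k \<omega>) - f t y)" for k
    define e where "e k = Reg + diameter C * (\<Sum>t=1..T. norm (estimation_error t k \<omega>))" for k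
    have "h (Suc k) \<le> (1 - 1 / (real k + 3)) * h k + 1 / (real k + 3) * e k
        + (1 / (real k + 3))\<^sup>2 * (real T * c)" if k: "k \<in> {1..K}" for k
    proof -
      have "h (Suc k) \<le> (\<Sum>t=1..T. (1 - 1 / (real k + 3)) * (f t (x t k \<omega>) - f t y)
          + 1 / (real k + 3) * (gf t (x t k \<omega>) \<bullet> (v t k \<omega> - y)) + (1 / (real k + 3))\<^sup>2 * c)"
        unfolding h_def using elim k by (intro sum_mono step) auto
      also have "\<dots> = (1 - 1 / (real k + 3)) * h k
          + 1 / (real k + 3) * (\<Sum>t=1..T. gf t (x t k \<omega>) \<bullet> (v t k \<omega> - y))
          + (1 / (real k + 3))\<^sup>2 * (real T * c)"
        unfolding h_def sum.distrib sum_distrib_left[symmetric] by simp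
      also have "\<dots> \<le> (1 - 1 / (real k + 3)) * h k + 1 / (real k + 3) * e k
          + (1 / (real k + 3))\<^sup>2 * (real T * c)"
        using elim(1) k unfolding e_def by (intro add_mono mult_left_mono order_refl) auto
      finally show ?thesis .
    qed
    from weighted_descent[of K h e, OF this]
    have "(real K + 3) * h (Suc K)
        \<le> 3 * h 1 + (\<Sum>k=1..K. e k) + real T * c * (\<Sum>k=1..K. 1 / (real k + 3))" .
    moreover have "h 1 = (\<Sum>t=1..T. f t z - f t y)"
      using run_eqs(2)[OF elim(2)] by (simp add: h_def)
    moreover have "(\<Sum>k=1..K. e k) = real K * Reg + diameter C * ?W \<omega>"
      by (simp add: e_def sum.distrib sum_distrib_left)
    ultimately show ?case by (simp add: h_def sum_subtractf)
  qed
  hence "expectation (\<lambda>\<omega>. (real K + 3) * (?F \<omega> - (\<Sum>t=1..T. f t y)))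
      \<le> expectation (\<lambda>\<omega>. ?B + diameter C * ?W \<omega>)"
    by (intro integral_mono_AE integrable_mult_right Bochner_Integration.integrable_diff
        Bochner_Integration.integrable_add F W) auto
  moreover have "expectation (\<lambda>\<omega>. (real K + 3) * (?F \<omega> - (\<Sum>t=1..T. f t y)))
      = (real K + 3) * (expectation ?F - (\<Sum>t=1..T. f t y))"
    using F by (simp add: prob_space)
  moreover have "expectation (\<lambda>\<omega>. ?B + diameter C * ?W \<omega>) = ?B + diameter C * expectation ?W"
    using W by (subst Bochner_Integration.integral_add) (simp_all add: prob_space)
  ultimately show ?thesis by linarith
qed

lemma submodular_version_bound:
  assumes ver: "ver = Submodular_Max" and y: "y \<in> C" and c: "0 \<le> c"
    and step: "\<And>t k \<omega>. t \<in> {1..T} \<Longrightarrow> k \<in> {1..K} \<Longrightarrow> \<omega> \<in> space M \<Longrightarrow>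
      f t y - f t (x t (Suc k) \<omega>) \<le> exp (- (1 / real K)) * (f t y - f t (x t k \<omega>))
        + (1 - exp (- (1 / real K))) * (gf t (x t k \<omega>) \<bullet> (y - v t k \<omega>) + c)"
    and F: "integrable M (\<lambda>\<omega>. \<Sum>t=1..T. f t (x t (Suc K) \<omega>))"
    and W: "integrable M (\<lambda>\<omega>. \<Sum>k=1..K. \<Sum>t=1..T. norm (estimation_error t k \<omega>))"
  shows "(\<Sum>t=1..T. f t y) - expectation (\<lambda>\<omega>. \<Sum>t=1..T. f t (x t (Suc K) \<omega>))
    \<le> (\<Sum>t=1..T. f t y - f t z) / exp 1 + Reg
      + diameter C / real K * expectation (\<lambda>\<omega>. \<Sum>k=1..K. \<Sum>t=1..T. norm (estimation_error t k \<omega>))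
      + real T * c"
proof -
  let ?W = "\<lambda>\<omega>. \<Sum>k=1..K. \<Sum>t=1..T. norm (estimation_error t k \<omega>)"
  let ?F = "\<lambda>\<omega>. \<Sum>t=1..T. f t (x t (Suc K) \<omega>)"
  let ?B = "(\<Sum>t=1..T. f t y - f t z) / exp 1 + Reg + real T * c"
  define q where "q = exp (- (1 / real K))"
  have q: "q \<le> 1" by (simp add: q_def)
  have Reg: "0 \<le> Reg" using regret_nonneg y by blast
  have "AE \<omega> in M. (\<Sum>t=1..T. f t y) - ?F \<omega> \<le> ?B + diameter C / real K * ?W \<omega>"
    using linear_gap(2)[OF y ver] AE_space
  proof eventually_elim
    case (elim \<omega>)
    define h where "h k = (\<Sum>t=1..T. f t y - f t (x t k \<omega>))" for k
    define e where "e k = Reg + diameter C * (\<Sum>t=1..T. norm (estimation_error t k \<omega>)) + real T * c" for k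
    have e0: "0 \<le> e k" for k
      unfolding e_def using Reg c diameter_ge_0[OF compact_imp_bounded[OF compact_C]]
      by (intro add_nonneg_nonneg mult_nonneg_nonneg sum_nonneg) auto
    have "h (Suc k) \<le> exp (- (1 / real K)) * h k + (1 - exp (- (1 / real K))) * e k"
      if k: "k \<in> {1..K}" for k
    proof -
      have "h (Suc k) \<le> (\<Sum>t=1..T. q * (f t y - f t (x t k \<omega>))
          + (1 - q) * (gf t (x t k \<omega>) \<bullet> (y - v t k \<omega>) + c))"
        unfolding h_def q_def using elim k by (intro sum_mono step) auto
      also have "\<dots> = q * h k + (1 - q) * ((\<Sum>t=1..T. gf t (x t k \<omega>) \<bullet> (y - v t k \<omega>)) + real T * c)"
        unfolding h_def sum.distrib sum_distrib_left[symmetric] by simp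
      also have "\<dots> \<le> q * h k + (1 - q) * e k"
        using elim(1) k q unfolding e_def by (intro add_mono mult_left_mono order_refl) auto
      finally show ?thesis by (simp add: q_def)
    qed
    from geometric_ascent[of K h "1 / real K" e, OF this e0]
    have "h (Suc K) \<le> exp (- (real K * (1 / real K))) * h 1 + 1 / real K * (\<Sum>k=1..K. e k)" by simp
    \<comment> \<open>The \<open>K\<close> contractions multiply to \<open>exp (- 1)\<close>, the
      origin of \<open>1 / e\<close> in the approximation ratio.\<close>
    moreover have "exp (- (real K * (1 / real K))) * h 1 = (\<Sum>t=1..T. f t y - f t z) / exp 1"
      using run_eqs(2)[OF elim(2)] K_pos by (simp add: h_def exp_minus divide_inverse mult.commute)
    moreover have "1 / real K * (\<Sum>k=1..K. e k) = Reg + diameter C / real K * ?W \<omega> + real T * c"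
      using K_pos by (simp add: e_def sum.distrib sum_distrib_left[symmetric] field_simps)
    ultimately show ?case by (simp add: h_def sum_subtractf)
  qed
  hence "expectation (\<lambda>\<omega>. (\<Sum>t=1..T. f t y) - ?F \<omega>) \<le> expectation (\<lambda>\<omega>. ?B + diameter C / real K * ?W \<omega>)"
    by (intro integral_mono_AE integrable_mult_right Bochner_Integration.integrable_diff
        Bochner_Integration.integrable_add F W) auto
  moreover have "expectation (\<lambda>\<omega>. (\<Sum>t=1..T. f t y) - ?F \<omega>) = (\<Sum>t=1..T. f t y) - expectation ?F"
    using F by (simp add: prob_space)
  moreover have "expectation (\<lambda>\<omega>. ?B + diameter C / real K * ?W \<omega>) = ?B + diameter C / real K * expectation ?W"
    using W by (subst Bochner_Integration.integral_add) (simp_all add: prob_space)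
  ultimately show ?thesis by linarith
qed

end

section \<open>Location of the iterates and final constants\<close>

lemma convex_version_iterate_in:
  fixes C :: "'a::real_vector set"
  assumes "convex C" "x 1 \<in> C" "\<And>k. k \<in> {1..K} \<Longrightarrow> 0 \<le> \<eta> k \<and> \<eta> k \<le> 1"
    and "\<And>k. k \<in> {1..K} \<Longrightarrow> v k \<in> C"
    and "\<And>k. k \<in> {1..K} \<Longrightarrow> x (Suc k) = (1 - \<eta> k) *\<^sub>R x k + \<eta> k *\<^sub>R v k"
    and "1 \<le> k" "k \<le> Suc K"
  shows "x k \<in> C"
  using assms(6,7)
proof (induction k rule: nat_induct_at_least)
  case (Suc k)
  thus ?case using assms(3,4,5)[of k] by (auto intro!: convexD[OF assms(1)])
qed (use assms(2) in simp)

text \<open>The point \<open>c\<close> is the mean of the first \<open>k\<close> outputs. The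
  scaling \<open>k / K\<close> reaches 1 only at the end, so the point played lies in
  \<open>C\<close> although the start 0 need not.\<close>

lemma submodular_version_iterate:
  fixes C :: "'a::real_vector set"
  assumes "convex C" "x 1 = 0" "1 \<le> K" "\<And>k. k \<in> {1..K} \<Longrightarrow> v k \<in> C"
    and "\<And>k. k \<in> {1..K} \<Longrightarrow> x (Suc k) = x k + (1 / real K) *\<^sub>R v k"
    and "1 \<le> k" "k \<le> K"
  shows "\<exists>c\<in>C. x (Suc k) = (real k / real K) *\<^sub>R c"
  using assms(6,7)
proof (induction k rule: nat_induct_at_least)
  case base
  thus ?case using assms(2,3,4) assms(5)[of 1] by auto
next
  case (Suc k)
  then obtain c where c: "c \<in> C" "x (Suc k) = (real k / real K) *\<^sub>R c" by auto
  let ?n = "real (Suc k)"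
  have "(real k / ?n) *\<^sub>R c + (1 / ?n) *\<^sub>R v (Suc k) \<in> C"
    using Suc.prems by (intro convexD[OF assms(1)] c assms(4)) (auto simp: add_divide_distrib[symmetric])
  moreover have "x (Suc (Suc k)) = (?n / real K) *\<^sub>R ((real k / ?n) *\<^sub>R c + (1 / ?n) *\<^sub>R v (Suc k))"
    using assms(5)[of "Suc k"] Suc.prems c(2) by (simp add: scaleR_add_right)
  ultimately show ?case by blast
qed

theorem theorem1:
  fixes M :: "'w measure" and H :: "nat \<Rightarrow> nat \<Rightarrow> 'w measure"
    and T K :: nat
    and C S V :: "(real ^ 'n) set"
    and f :: "nat \<Rightarrow> real ^ 'n \<Rightarrow> real"
    and gf :: "nat \<Rightarrow> real ^ 'n \<Rightarrow> real ^ 'n"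
    and G :: "nat \<Rightarrow> nat \<Rightarrow> real ^ 'n \<Rightarrow> 'w \<Rightarrow> real ^ 'n"
    and A :: "nat \<Rightarrow> (real ^ 'n) list \<Rightarrow> real ^ 'n"
    and x v d :: "nat \<Rightarrow> nat \<Rightarrow> 'w \<Rightarrow> real ^ 'n"
    and z :: "real ^ 'n"
    and \<rho> \<eta> :: "nat \<Rightarrow> real"
    and ver :: mfw_version
    and L \<sigma> Reg D R :: real
  assumes "prob_space M"
    and "1 \<le> T" and "1 \<le> K"
    and "C \<noteq> {}" and "convex C" and "compact C"
    and "D = diameter C" and "R = (SUP y\<in>C. norm y)"
    and "C \<subseteq> S"
    and smooth: "\<And>t. t \<in> {1..T} \<Longrightarrow> smooth_on L (f t) (gf t) S"
    and past_subalgebra: "\<And>t k. t \<in> {1..T} \<Longrightarrow> k \<in> {1..K} \<Longrightarrow> subalgebra M (H t k)"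
    and past_answers: "\<And>t k s j. t \<in> {1..T} \<Longrightarrow> k \<in> {1..K} \<Longrightarrow> s \<in> {1..T} \<Longrightarrow> j \<in> {1..K} \<Longrightarrow>
            s < t \<or> (s = t \<and> j < k) \<Longrightarrow>
            (\<lambda>\<omega>. G s j (x s j \<omega>) \<omega>) \<in> borel_measurable (H t k)"
    and gradient_oracle: "\<And>t k. t \<in> {1..T} \<Longrightarrow> k \<in> {1..K} \<Longrightarrow>
            stochastic_gradient_query M (H t k) S (gf t) \<sigma> (G t k)"
    and linear_oracles: "\<And>k. k \<in> {1..K} \<Longrightarrow> linear_optimization_oracle ver T C V Reg (A k)"
    and "0 \<in> V"
    and feedback: "AE \<omega> in M. \<forall>t\<in>{1..T}. \<forall>k\<in>{1..K}. d t k \<omega> \<in> V"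
    and \<rho>: "\<And>k. k \<in> {1..K} \<Longrightarrow> \<rho> k = 2 / (real k + 3) powr (2/3)"
    and run: "\<And>\<omega>. \<omega> \<in> space M \<Longrightarrow>
            meta_frank_wolfe ver T K \<rho> \<eta> z A (\<lambda>t k y. G t k y \<omega>)
              (\<lambda>t k. x t k \<omega>) (\<lambda>t k. v t k \<omega>) (\<lambda>t k. d t k \<omega>)"
  shows
    "(\<forall>x_opt Mz Q.
        ver = Convex_Min \<longrightarrow>
        convex S \<longrightarrow>
        (\<forall>t\<in>{1..T}. convex_on S (f t)) \<longrightarrow>
        z \<in> C \<longrightarrow>
        (\<forall>k\<in>{1..K}. \<eta> k = 1 / (real k + 3)) \<longrightarrow>
        is_arg_min (\<lambda>y. \<Sum>t=1..T. f t y) (\<lambda>y. y \<in> C) x_opt \<longrightarrow>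
        Mz = Max ((\<lambda>t. f t z - f t x_opt) ` {1..T}) \<longrightarrow>
        Q = max (4 powr (2/3) * Max ((\<lambda>t. (norm (gf t z))\<^sup>2) ` {1..T}))
                (4 * \<sigma>\<^sup>2 + 3 * (L * D)\<^sup>2 / 2) \<longrightarrow>
        prob_space.expectation M (\<lambda>\<omega>. \<Sum>t=1..T. f t (x t (K + 1) \<omega>)) - (INF y\<in>C. \<Sum>t=1..T. f t y)
          \<le> 4 * real T * D * Q powr (1/2) / real K powr (1/3)
             + 4 * real T / real K * (Mz + L * D\<^sup>2 / 3 * ln (real K + 1))
             + 4 / 3 * Reg)
     \<and>
     (\<forall>I Q.
        ver = Submodular_Max \<longrightarrow>
        (\<forall>i. compact (I i) \<and> is_interval (I i) \<and> 0 \<in> I i \<and> I i \<subseteq> {0..}) \<longrightarrow>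
        S = {y. \<forall>i. y $ i \<in> I i} \<longrightarrow>
        (\<forall>t\<in>{1..T}. (\<forall>y\<in>S. 0 \<le> f t y) \<and> mono_on S (f t) \<and> dr_submodular_on (f t) (gf t) S) \<longrightarrow>
        z = 0 \<longrightarrow>
        (\<forall>k\<in>{1..K}. \<eta> k = 1 / real K) \<longrightarrow>
        Q = max (4 powr (2/3) * Max ((\<lambda>t. (norm (gf t 0))\<^sup>2) ` {1..T}))
                (4 * \<sigma>\<^sup>2 + 6 * L\<^sup>2 * R\<^sup>2) \<longrightarrow>
        (1 - 1 / exp 1) * (SUP y\<in>C. \<Sum>t=1..T. f t y)
            - prob_space.expectation M (\<lambda>\<omega>. \<Sum>t=1..T. f t (x t (K + 1) \<omega>))
          \<le> 3 * real T * D * Q powr (1/2) / (2 * real K powr (1/3))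
             + L * D\<^sup>2 * real T / (2 * real K)
             + Reg)"
proof -
  interpret prob_space M by fact
  have bC: "bounded C" using \<open>compact C\<close> by (rule compact_imp_bounded)
  have D0: "0 \<le> D" unfolding \<open>D = diameter C\<close> by (rule diameter_ge_0[OF bC])
  have diam: "norm (a - b) \<le> D" if "a \<in> C" "b \<in> C" for a b
    using diameter_bounded_bound[OF bC that] by (simp add: \<open>D = diameter C\<close> dist_norm)
  have grad: "has_gradient_on (f t) (gf t) S" and lip: "L-lipschitz_on S (gf t)" if "t \<in> {1..T}" for t
    using smooth[OF that] by (simp_all add: smooth_on_def)
  have L0: "0 \<le> L" using lip[of 1] \<open>1 \<le> T\<close> by (auto dest: lipschitz_on_nonneg)
  have cont: "continuous_on C (f t)" if "t \<in> {1..T}" for t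
  proof (rule continuous_on_subset[OF _ \<open>C \<subseteq> S\<close>])
    show "continuous_on S (f t)"
      using grad[OF that] unfolding has_gradient_on_def
      by (intro has_derivative_continuous_on) auto
  qed
  have eqs: "x t 1 \<omega> = z" "x t (Suc k) \<omega> = fw_step ver (\<eta> k) (x t k \<omega>) (v t k \<omega>)" "v t k \<omega> \<in> C"
    if "\<omega> \<in> space M" "t \<in> {1..T}" "k \<in> {1..K}" for \<omega> t k
    using run[OF that(1)] that linear_oracles[OF that(3)]
    by (auto simp: meta_frank_wolfe_def linear_optimization_oracle_def)
  have drift: "norm (gf t (x t k \<omega>) - gf t (x t j \<omega>)) \<le> L * r"
    if "t \<in> {1..T}" "x t k \<omega> \<in> S" "x t j \<omega> \<in> S" "norm (x t k \<omega> - x t j \<omega>) \<le> r" for t k j \<omega> r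
  proof -
    have "norm (gf t (x t k \<omega>) - gf t (x t j \<omega>)) \<le> L * norm (x t k \<omega> - x t j \<omega>)"
      using lipschitz_onD[OF lip[OF that(1)] that(2,3)] by (simp add: dist_norm)
    also have "\<dots> \<le> L * r" using L0 that(4) by (rule mult_left_mono[rotated])
    finally show ?thesis .
  qed
  have Max_le: "h t \<le> Max (h ` {1..T})" if "t \<in> {1..T}" for h :: "nat \<Rightarrow> real" and t
    using that by (intro Max_ge) auto
  have K0: "0 < real K" using \<open>1 \<le> K\<close> by simp
  have K_root: "real K powr (2/3) / real K = 1 / real K powr (1/3)"
  proof -
    have "real K powr (2/3) / real K powr 1 = real K powr (2/3 - 1)" by (rule powr_diff[symmetric])
    also have "\<dots> = 1 / real K powr (1/3)" by (simp add: powr_minus_divide)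
    finally show ?thesis using K0 by simp
  qed
  show ?thesis
  proof (intro conjI allI impI, goal_cases)
    case (1 x_opt Mz Q)
    have y: "x_opt \<in> C" and opt: "\<And>w. w \<in> C \<Longrightarrow> (\<Sum>t=1..T. f t x_opt) \<le> (\<Sum>t=1..T. f t w)"
      using 1 by (auto simp: is_arg_min_linorder)
    have conv: "\<And>t. t \<in> {1..T} \<Longrightarrow> convex_on S (f t)" and \<eta>: "\<And>k. k \<in> {1..K} \<Longrightarrow> \<eta> k = 1 / (real k + 3)"
      using 1 by auto
    have next_x: "x t (Suc k) \<omega> = (1 - \<eta> k) *\<^sub>R x t k \<omega> + \<eta> k *\<^sub>R v t k \<omega>"
      if "\<omega> \<in> space M" "t \<in> {1..T}" "k \<in> {1..K}" for \<omega> t k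
      using eqs(2)[OF that] 1 by simp
    have xC: "x t k \<omega> \<in> C" if "\<omega> \<in> space M" "t \<in> {1..T}" "1 \<le> k" "k \<le> Suc K" for \<omega> t k
      using that(3,4)
    proof (rule convex_version_iterate_in[OF \<open>convex C\<close>, of "\<lambda>k. x t k \<omega>" K \<eta> "\<lambda>k. v t k \<omega>", rotated -2])
      show "x t 1 \<omega> \<in> C" using eqs(1)[OF that(1,2), of 1] 1 \<open>1 \<le> K\<close> by simp
    qed (use next_x[OF that(1,2)] eqs(3)[OF that(1,2)] \<eta> in auto)
    have in_S: "x t k \<omega> \<in> S" if "t \<in> {1..T}" "k \<in> {1..K}" "\<omega> \<in> space M" for t k \<omega>
      using that xC[of \<omega> t k] \<open>C \<subseteq> S\<close> by auto
    interpret R: meta_frank_wolfe_run M H T K C S V gf G A x v d z \<rho> \<eta> ver L \<sigma> Reg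
      by unfold_locales (fact assms lip in_S)+
    \<comment> \<open>The step leading to iterate \<open>k\<close> has size
      \<open>\<eta> (k - 1) = 1 / (k + 2)\<close> and direction of length at most \<open>D\<close>.
      At \<open>k = 1\<close> the index \<open>max 1 (k - 1)\<close> is \<open>k\<close> itself,
      hence the value 0.\<close>
    define \<delta> where "\<delta> k = (if k = 1 then 0 else (L * (D / (real k + 2)))\<^sup>2)" for k :: nat
    define B where "B = 3 * (L * D)\<^sup>2 / 2"
    let ?W = "\<lambda>\<omega>. \<Sum>k=1..K. \<Sum>t=1..T. norm (R.estimation_error t k \<omega>)"
    have Qt: "4 powr (2/3) * (norm (gf t z))\<^sup>2 \<le> Q" if "t \<in> {1..T}" for t
    proof -
      have "4 powr (2/3) * (norm (gf t z))\<^sup>2 \<le> 4 powr (2/3) * Max ((\<lambda>t. (norm (gf t z))\<^sup>2) ` {1..T})"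
        using Max_le[OF that] by (intro mult_left_mono) auto
      thus ?thesis using 1 by (simp add: le_max_iff_disj)
    qed
    have QB: "4 * \<sigma>\<^sup>2 + B \<le> Q" using 1 by (simp add: B_def)
    have Q0: "0 \<le> Q" using QB by (rule order_trans[rotated]) (simp add: B_def)
    have dr: "(norm (gf t (x t k \<omega>) - gf t (x t (max 1 (k - 1)) \<omega>)))\<^sup>2 \<le> \<delta> k"
      if t: "t \<in> {1..T}" "k \<in> {1..K}" "\<omega> \<in> space M" for t k \<omega>
    proof (cases "k = 1")
      case False
      then obtain j where j: "k = Suc j" "j \<in> {1..K}" using t by (cases k) auto
      have "x t k \<omega> - x t j \<omega> = \<eta> j *\<^sub>R (v t j \<omega> - x t j \<omega>)"
        using next_x[OF t(3,1) j(2)] j by (simp add: algebra_simps)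
      also have "norm \<dots> = 1 / (real k + 2) * norm (v t j \<omega> - x t j \<omega>)"
        using \<eta>[OF j(2)] j by simp
      also have "\<dots> \<le> 1 / (real k + 2) * D"
        using diam[OF eqs(3)[OF t(3,1) j(2)] xC[OF t(3,1)]] j by (intro mult_left_mono) auto
      finally have "norm (x t k \<omega> - x t j \<omega>) \<le> D / (real k + 2)" by simp
      hence "norm (gf t (x t k \<omega>) - gf t (x t j \<omega>)) \<le> L * (D / (real k + 2))"
        using xC[OF t(3,1)] t j \<open>C \<subseteq> S\<close> by (intro drift) auto
      thus ?thesis using j by (simp add: \<delta>_def max_def power_mono)
    qed (simp add: \<delta>_def)
    have \<delta>: "((real k + 3)\<^sup>2 - (real k + 3)) * \<delta> k \<le> B" if "k \<in> {1..K}" for k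
    proof (cases "k = 1")
      case False
      \<comment> \<open>Here \<open>m\<close> is one less than in \<open>momentum_recursion\<close>;
        the weight becomes \<open>(m + 1) * m\<close>, and \<open>m \<ge> 4\<close> leaves a ratio
        of at most 5/4.\<close>
      define m where "m = real k + 2"
      have m: "4 \<le> m" using False that by (auto simp: m_def)
      have "((real k + 3)\<^sup>2 - (real k + 3)) * \<delta> k = ((m + 1)\<^sup>2 - (m + 1)) * (L * (D / m))\<^sup>2"
        using False by (simp add: \<delta>_def m_def add.assoc)
      also have "\<dots> = (m + 1) / m * (L * D)\<^sup>2"
        using m by (simp add: field_simps power2_eq_square)
      also have "\<dots> \<le> 3 / 2 * (L * D)\<^sup>2"
        using m by (intro mult_right_mono) (auto simp: field_simps)
      finally show ?thesis by (simp add: B_def)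
    qed (simp add: \<delta>_def B_def)
    note W = R.total_estimation_error[OF Qt QB Q0 dr \<delta>]
    have F: "integrable M (\<lambda>\<omega>. \<Sum>t=1..T. f t (x t (Suc K) \<omega>))"
      using xC cont by (intro R.final_value_integrable) auto
    have step: "f t (x t (Suc k) \<omega>) - f t x_opt \<le> (1 - 1 / (real k + 3)) * (f t (x t k \<omega>) - f t x_opt)
        + 1 / (real k + 3) * (gf t (x t k \<omega>) \<bullet> (v t k \<omega> - x_opt)) + (1 / (real k + 3))\<^sup>2 * (L * D\<^sup>2)"
      if t: "t \<in> {1..T}" "k \<in> {1..K}" "\<omega> \<in> space M" for t k \<omega>
    proof -
      have in_C: "x t k \<omega> \<in> C" "v t k \<omega> \<in> C" using xC[OF t(3,1)] eqs(3)[OF t(3,1,2)] t(2) by auto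
      show ?thesis
        unfolding next_x[OF t(3,1,2)] \<eta>[OF t(2)]
        using in_C y \<open>C \<subseteq> S\<close>
        by (intro convex_frank_wolfe_step[OF smooth[OF t(1)] conv[OF t(1)]] diam) auto
    qed
    define X where "X = expectation (\<lambda>\<omega>. \<Sum>t=1..T. f t (x t (Suc K) \<omega>)) - (\<Sum>t=1..T. f t x_opt)"
    define P where "P = 3 * (real T * Mz) + real K * Reg
      + D * (real T * (sqrt Q * (3/2 * real K powr (2/3)))) + real T * (L * D\<^sup>2) * ln (real K + 1)"
    have sumz: "(\<Sum>t=1..T. f t z - f t x_opt) \<le> real T * Mz"
      using sum_mono[of "{1..T}" "\<lambda>t. f t z - f t x_opt" "\<lambda>t. Mz"] Max_le[of _ "\<lambda>t. f t z - f t x_opt"] 1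
      by simp
    \<comment> \<open>Single differences \<open>f t z - f t x_opt\<close> may be negative, but their
      sum is not, by optimality of \<open>x_opt\<close>.\<close>
    have TM: "0 \<le> real T * Mz"
      using sumz opt[of z] 1 by (simp add: sum_subtractf)
    hence "0 \<le> Mz" using \<open>1 \<le> T\<close> by (simp add: zero_le_mult_iff)
    have Reg0: "0 \<le> Reg" using R.regret_nonneg y by blast
    have ln0: "0 \<le> ln (real K + 1)" by simp
    have "(real K + 3) * X \<le> 3 * (\<Sum>t=1..T. f t z - f t x_opt) + real K * Reg
      + D * expectation ?W + real T * (L * D\<^sup>2) * (\<Sum>k=1..K. 1 / (real k + 3))"
      using R.convex_version_bound[OF 1(1) y step F W(1)] by (simp add: X_def \<open>D = diameter C\<close>)
    also have "\<dots> \<le> P"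
      unfolding P_def
    proof (intro add_mono mult_left_mono sumz order_refl sum_harmonic_shift_le_ln)
      show "expectation ?W \<le> real T * (sqrt Q * (3/2 * real K powr (2/3)))"
      proof -
        have "sqrt Q * (3/2 * real K powr (2/3) - 1/2) \<le> sqrt Q * (3/2 * real K powr (2/3))"
          using Q0 by (intro mult_left_mono) auto
        from mult_left_mono[OF this, of "real T"] W(2) show ?thesis by linarith
      qed
    qed (use D0 L0 in auto)
    finally have XP: "(real K + 3) * X \<le> P" .
    \<comment> \<open>This permits replacing the divisor \<open>K + 3\<close> by
      \<open>K\<close>.\<close>
    have P0: "0 \<le> P"
      unfolding P_def using \<open>0 \<le> Mz\<close> Reg0 D0 L0 Q0 ln0
      by (intro add_nonneg_nonneg mult_nonneg_nonneg) auto
    have "X \<le> P / (real K + 3)" using XP by (simp add: field_simps)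
    also have "\<dots> \<le> P / real K" using P0 K0 by (intro divide_left_mono) auto
    also have "\<dots> = 3 * (real T * Mz / real K) + Reg
        + 3/2 * (real T * D * sqrt Q * (real K powr (2/3) / real K)) + real T * L * D\<^sup>2 * ln (real K + 1) / real K"
      unfolding P_def using K0 by (simp add: add_divide_distrib mult_ac)
    also have "\<dots> \<le> 4 * (real T * Mz / real K) + 4/3 * Reg
        + 4 * (real T * D * sqrt Q * (real K powr (2/3) / real K)) + 4/3 * (real T * L * D\<^sup>2 * ln (real K + 1) / real K)"
    proof -
      \<comment> \<open>Every coefficient obtained is below the stated one; the four quantities are
        nonnegative, so the bound may be enlarged.\<close>
      have "3 * p + r + 3/2 * q + s \<le> 4 * p + 4/3 * r + 4 * q + 4/3 * s"
        if "0 \<le> p" "0 \<le> r" "0 \<le> q" "0 \<le> s" for p q r s :: real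
        using that by linarith
      thus ?thesis by this (use TM Reg0 D0 Q0 L0 ln0 in simp_all)
    qed
    also have "\<dots> = 4 * real T * D * Q powr (1/2) / real K powr (1/3)
        + 4 * real T / real K * (Mz + L * D\<^sup>2 / 3 * ln (real K + 1)) + 4 / 3 * Reg"
      unfolding K_root using Q0 K0 by (simp add: powr_half_sqrt field_simps)
    finally have main: "X \<le> 4 * real T * D * Q powr (1/2) / real K powr (1/3)
        + 4 * real T / real K * (Mz + L * D\<^sup>2 / 3 * ln (real K + 1)) + 4 / 3 * Reg" .
    have "(\<Sum>t=1..T. f t x_opt) \<le> (INF y\<in>C. \<Sum>t=1..T. f t y)"
      using opt \<open>C \<noteq> {}\<close> by (intro cINF_greatest) auto
    with main show ?case by (simp add: X_def)
  next
    case (2 I Q)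
    have box: "S = {y. \<forall>i. y $ i \<in> I i}" "\<And>i. is_interval (I i)" "\<And>i. 0 \<in> I i" "\<And>i. I i \<subseteq> {0..}"
      using 2 by auto
    have cS: "convex S" unfolding box(1) using box(2) by (rule box_convex)
    have zS: "0 \<in> S" using box(1,3) by simp
    have mono: "mono_on S (f t)" and dr_sub: "dr_submodular_on (f t) (gf t) S"
      and nonneg: "\<And>y. y \<in> S \<Longrightarrow> 0 \<le> f t y" if "t \<in> {1..T}" for t
      using 2 that by auto
    have \<eta>: "\<And>k. k \<in> {1..K} \<Longrightarrow> \<eta> k = 1 / real K" using 2 by auto
    have R: "norm y \<le> R" if "y \<in> C" for y
      unfolding \<open>R = (SUP y\<in>C. norm y)\<close>
      using bC that by (intro cSUP_upper) (auto simp: bounded_iff bdd_above_def)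
    obtain y0 where "y0 \<in> C" using \<open>C \<noteq> {}\<close> by blast
    hence R0: "0 \<le> R" using R norm_ge_zero order_trans by blast
    have next_x: "x t (Suc k) \<omega> = x t k \<omega> + (1 / real K) *\<^sub>R v t k \<omega>"
      if "\<omega> \<in> space M" "t \<in> {1..T}" "k \<in> {1..K}" for \<omega> t k
      using eqs(2)[OF that] \<eta>[OF that(3)] 2 by simp
    have first_x: "x t 1 \<omega> = 0" if "\<omega> \<in> space M" "t \<in> {1..T}" for \<omega> t
      using eqs(1)[OF that, of 1] 2 \<open>1 \<le> K\<close> by simp
    have scaled: "\<exists>c\<in>C. x t (Suc k) \<omega> = (real k / real K) *\<^sub>R c"
      if "\<omega> \<in> space M" "t \<in> {1..T}" "k \<in> {1..K}" for \<omega> t k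
      using submodular_version_iterate[OF \<open>convex C\<close>, of "\<lambda>k. x t k \<omega>" K "\<lambda>k. v t k \<omega>" k]
        first_x[OF that(1,2)] next_x[OF that(1,2)] eqs(3)[OF that(1,2)] that(3) \<open>1 \<le> K\<close> by auto
    have xS: "x t k \<omega> \<in> S" if t: "\<omega> \<in> space M" "t \<in> {1..T}" "1 \<le> k" "k \<le> Suc K" for \<omega> t k
    proof (cases "k = 1")
      case True
      thus ?thesis using first_x[OF t(1,2)] zS by simp
    next
      case False
      then obtain j where j: "k = Suc j" "j \<in> {1..K}" using t by (cases k) auto
      then obtain c where c: "c \<in> C" "x t k \<omega> = (real j / real K) *\<^sub>R c"
        using scaled[OF t(1,2) j(2)] by auto
      \<comment> \<open>An intermediate iterate is a convex combination of 0 and a point of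
        \<open>C\<close>, both in the convex box.\<close>
      have "(1 - real j / real K) *\<^sub>R 0 + (real j / real K) *\<^sub>R c \<in> S"
        using c(1) \<open>C \<subseteq> S\<close> j(2) K0 by (intro convexD[OF cS zS]) auto
      thus ?thesis using c(2) by simp
    qed
    have last_x: "x t (Suc K) \<omega> \<in> C" if "\<omega> \<in> space M" "t \<in> {1..T}" for \<omega> t
      using scaled[OF that, of K] \<open>1 \<le> K\<close> K0 by auto
    have in_S: "x t k \<omega> \<in> S" if "t \<in> {1..T}" "k \<in> {1..K}" "\<omega> \<in> space M" for t k \<omega>
      using that by (intro xS) auto
    interpret R: meta_frank_wolfe_run M H T K C S V gf G A x v d z \<rho> \<eta> ver L \<sigma> Reg
      by unfold_locales (fact assms lip in_S)+
    \<comment> \<open>The value 0 at \<open>k = 1\<close> matters for \<open>K = 1\<close>: the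
      weight 12 there would exceed the 6 in \<open>B\<close>.\<close>
    define \<delta> where "\<delta> k = (if k = 1 then 0 else (L * (R / real K))\<^sup>2)" for k :: nat
    define B where "B = 6 * L\<^sup>2 * R\<^sup>2"
    let ?W = "\<lambda>\<omega>. \<Sum>k=1..K. \<Sum>t=1..T. norm (R.estimation_error t k \<omega>)"
    have z: "z = 0" by (fact 2)
    have Qt: "4 powr (2/3) * (norm (gf t z))\<^sup>2 \<le> Q" if "t \<in> {1..T}" for t
    proof -
      have "4 powr (2/3) * (norm (gf t z))\<^sup>2 \<le> 4 powr (2/3) * Max ((\<lambda>t. (norm (gf t z))\<^sup>2) ` {1..T})"
        using Max_le[OF that] by (intro mult_left_mono) auto
      thus ?thesis using 2 by (simp add: le_max_iff_disj)
    qed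
    have QB: "4 * \<sigma>\<^sup>2 + B \<le> Q" using 2 by (simp add: B_def)
    have Q0: "0 \<le> Q" using QB by (rule order_trans[rotated]) (simp add: B_def)
    have dr: "(norm (gf t (x t k \<omega>) - gf t (x t (max 1 (k - 1)) \<omega>)))\<^sup>2 \<le> \<delta> k"
      if t: "t \<in> {1..T}" "k \<in> {1..K}" "\<omega> \<in> space M" for t k \<omega>
    proof (cases "k = 1")
      case False
      then obtain j where j: "k = Suc j" "j \<in> {1..K}" using t by (cases k) auto
      have "norm (x t k \<omega> - x t j \<omega>) = 1 / real K * norm (v t j \<omega>)"
        using next_x[OF t(3,1) j(2)] j by simp
      also have "\<dots> \<le> 1 / real K * R"
        using R[OF eqs(3)[OF t(3,1) j(2)]] by (intro mult_left_mono) auto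
      finally have "norm (gf t (x t k \<omega>) - gf t (x t j \<omega>)) \<le> L * (R / real K)"
        using xS[OF t(3,1)] t j by (intro drift) auto
      thus ?thesis using j by (simp add: \<delta>_def max_def power_mono)
    qed (simp add: \<delta>_def)
    have \<delta>: "((real k + 3)\<^sup>2 - (real k + 3)) * \<delta> k \<le> B" if "k \<in> {1..K}" for k
    proof (cases "k = 1")
      case False
      \<comment> \<open>Since \<open>k \<ge> 2\<close> forces \<open>K \<ge> 2\<close>, the bound
        \<open>(K + 3) * (K + 2) \<le> 6 * K\<^sup>2\<close> is available.\<close>
      have K2: "2 \<le> real K" "real k \<le> real K" using False that by auto
      have "(real k + 3) * (real k + 2) \<le> (real K + 3) * (real K + 2)"
        using K2 by (intro mult_mono) auto
      also have "\<dots> \<le> 6 * (real K)\<^sup>2"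
      proof -
        have "2 * real K \<le> real K * real K" using K2(1) by (intro mult_right_mono) auto
        moreover have "(real K + 3) * (real K + 2) = real K * real K + 5 * real K + 6"
          by (simp add: algebra_simps)
        ultimately show ?thesis using K2(1) unfolding power2_eq_square by linarith
      qed
      finally have "((real k + 3)\<^sup>2 - (real k + 3)) * (L * R)\<^sup>2 \<le> 6 * (real K)\<^sup>2 * (L * R)\<^sup>2"
        by (intro mult_right_mono[OF _ zero_le_power2]) (auto simp: power2_eq_square algebra_simps)
      thus ?thesis using False K0 by (simp add: \<delta>_def B_def power_mult_distrib power_divide field_simps)
    qed (simp add: \<delta>_def B_def)
    note W = R.total_estimation_error[OF Qt QB Q0 dr \<delta>]
    have F: "integrable M (\<lambda>\<omega>. \<Sum>t=1..T. f t (x t (Suc K) \<omega>))"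
      using last_x cont by (intro R.final_value_integrable) auto
    have LR: "L * R \<le> sqrt Q / 2"
    proof -
      have "(2 * (L * R))\<^sup>2 \<le> B" by (simp add: B_def power_mult_distrib)
      also have "B \<le> Q" using QB by (rule order_trans[rotated]) simp
      finally have "2 * (L * R) \<le> sqrt Q" by (rule real_le_rsqrt)
      thus ?thesis by simp
    qed
    define c where "c = 1 / real K * (L * R * D)"
    have c0: "0 \<le> c" using L0 R0 D0 by (simp add: c_def)
    define Bd where "Bd = 3 * real T * D * Q powr (1/2) / (2 * real K powr (1/3))
      + L * D\<^sup>2 * real T / (2 * real K) + Reg"
    let ?E = "expectation (\<lambda>\<omega>. \<Sum>t=1..T. f t (x t (Suc K) \<omega>))"
    have main: "(1 - 1 / exp 1) * (\<Sum>t=1..T. f t y) \<le> ?E + Bd" if y: "y \<in> C" for y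
    proof -
      have yS: "y \<in> S" using y \<open>C \<subseteq> S\<close> by blast
      have step: "f t y - f t (x t (Suc k) \<omega>) \<le> exp (- (1 / real K)) * (f t y - f t (x t k \<omega>))
          + (1 - exp (- (1 / real K))) * (gf t (x t k \<omega>) \<bullet> (y - v t k \<omega>) + c)"
        if t: "t \<in> {1..T}" "k \<in> {1..K}" "\<omega> \<in> space M" for t k \<omega>
      proof -
        have vC: "v t k \<omega> \<in> C" using eqs(3)[OF t(3,1,2)] .
        have xs: "x t k \<omega> \<in> S" "x t k \<omega> + (1 / real K) *\<^sub>R v t k \<omega> \<in> S"
          using xS[OF t(3,1), of k] xS[OF t(3,1), of "Suc k"] next_x[OF t(3,1,2)] t(2) by auto
        show ?thesis
          unfolding next_x[OF t(3,1,2)] c_def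
          by (rule dr_submodular_frank_wolfe_step[OF box dr_sub[OF t(1)] mono[OF t(1)] lip[OF t(1)]
              xs(1) yS xs(2) _ R[OF vC] diam[OF vC y]]) simp
      qed
      have "(\<Sum>t=1..T. f t y) - ?E \<le> (\<Sum>t=1..T. f t y - f t z) / exp 1 + Reg
          + D / real K * expectation ?W + real T * c"
        using R.submodular_version_bound[OF 2(1) y c0 step F W(1)] by (simp add: \<open>D = diameter C\<close>)
      also have "\<dots> \<le> (\<Sum>t=1..T. f t y) / exp 1 + Reg
          + D / real K * (real T * (sqrt Q * (3/2 * real K powr (2/3) - 1/2))) + real T * (D / real K * (sqrt Q / 2))"
      proof (intro add_mono order_refl divide_right_mono mult_left_mono W(2) sum_mono)
        \<comment> \<open>Nonnegativity of \<open>f t\<close> at the initial point 0 removes its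
          value from the bound.\<close>
        show "f t y - f t z \<le> f t y" if "t \<in> {1..T}" for t using nonneg[OF that zS] z by simp
        show "c \<le> D / real K * (sqrt Q / 2)"
          using mult_left_mono[OF LR, of "D / real K"] D0 by (simp add: c_def mult_ac)
      qed (use D0 in auto)
      \<comment> \<open>The discretisation error, bounded through \<open>LR\<close>, cancels exactly
        against the \<open>- 1/2\<close> of the cube root sum.\<close>
      also have "\<dots> = (\<Sum>t=1..T. f t y) / exp 1 + Reg + 3/2 * real T * D * sqrt Q * (real K powr (2/3) / real K)"
        using K0 by (simp add: field_simps)
      also have "\<dots> \<le> (\<Sum>t=1..T. f t y) / exp 1 + Bd"
        unfolding K_root Bd_def using L0 D0 Q0 by (simp add: powr_half_sqrt mult_ac)
      finally show ?thesis by (simp add: left_diff_distrib)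
    qed
    have e: "0 < 1 - 1 / exp (1::real)" by simp
    \<comment> \<open>The bound holds for every comparator, so it passes to the supremum after
      division by the positive approximation ratio.\<close>
    have "(SUP y\<in>C. \<Sum>t=1..T. f t y) \<le> (?E + Bd) / (1 - 1 / exp 1)"
      using \<open>C \<noteq> {}\<close> main by (intro cSUP_least) (auto simp only: pos_le_divide_eq[OF e] mult.commute)
    hence "(1 - 1 / exp 1) * (SUP y\<in>C. \<Sum>t=1..T. f t y) \<le> ?E + Bd"
      by (simp only: pos_le_divide_eq[OF e] mult.commute)
    thus ?case by (simp add: Bd_def)
  qed
qed

end
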